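(* Let $X,Y$ be Banach spaces, let $A:D(A)\subset X\to X$ generate a $C_0$-semigroup $T(\cdot)$ on $X$, and let $C\in\mathcal L(X,Y)$. For the system $\dot x(t)=Ax(t)$, $y(t)=Cx(t)$ consider the following statements: (i) The system is exponentially detectable. (ii) The system admits a coercive eOSS Lyapunov function in dissipation form with linear Lyapunov gain. (iii) The system admits a coercive eOSS Lyapunov function in implication form with linear Lyapunov gain. (iv) The system is eOSS with linear gain. (v) The system is eOSS. (vi) The system is OSS with linear gain. (vii) The system is OSS. (viii) The system is UGESMO. (ix) The system is exponentially zero-detectable. Then (i) $\Rightarrow$ (ii) $\Rightarrow$ (iii) $\Leftrightarrow$ (iv) $\Leftrightarrow$ (v) $\Leftrightarrow$ (vi) $\Leftrightarrow$ (vii) $\Leftrightarrow$ (viii) $\Rightarrow$ (ix).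
   Context: $\mathcal L(X,Y)$ denotes the bounded linear operators from $X$ to $Y$. $\mathbb R_+=[0,\infty)$. The mild solution with initial state $x\in X$ is $\phi(t,x)=T(t)x$ and the output trajectory is $y(t,x)=CT(t)x$, $t\ge0$. Comparison functions: $\mathcal K$ is the set of continuous strictly increasing $\gamma:\mathbb R_+\to\mathbb R_+$ with $\gamma(0)=0$; $\mathcal K_\infty$ is the set of unbounded $\gamma\in\mathcal K$. $\mathcal L$ is the set of continuous strictly decreasing functions $\mathbb R_+\to\mathbb R_+$ tending to $0$ at infinity. $\mathcal{KL}$ is the set of continuous $\beta:\mathbb R_+\times\mathbb R_+\to\mathbb R_+$ such that $\beta(\cdot,t)\in\mathcal K$ for all $t\ge0$ and $\beta(r,\cdot)\in\mathcal L$ for all $r>0$. Exponentially detectable: there exists $L\in\mathcal L(Y,X)$ such that $A+LC$ generates a uniformly exponentially stable $C_0$-semigroup, i.e. a semigroup $S(\cdot)$ with $\|S(t)x\|_X\le Me^{-\mu t}\|x\|_X$ for all $x\in X$, $t\ge0$ and some $M,\mu>0$. OSS: there exist $\beta\in\mathcal{KL}$, $\gamma\in\mathcal K$ such that for all $x\in X$, $t\ge0$: $\|\phi(t,x)\|_X\le\beta(\|x\|_X,t)+\gamma\bigl(\max_{s\in[0,t]}\|y(s,x)\|_Y\bigr)$; with linear gain if $\gamma$ can be chosen linear. eOSS: there exist $M,\mu>0$, $\gamma\in\mathcal K$ such that for all $x\in X$, $t\ge0$: $\|\phi(t,x)\|_X\le Me^{-\mu t}\|x\|_X+\gamma\bigl(\max_{s\in[0,t]}\|y(s,x)\|_Y\bigr)$;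 with linear gain if $\gamma$ can be chosen linear. UGESMO: there exist $\rho>0$ and $M,\mu>0$ such that for all $x\in X$, $\tau\ge0$: if $\|\phi(t,x)\|_X\ge\rho\|y(t,x)\|_Y$ for all $t\in[0,\tau]$, then $\|\phi(t,x)\|_X\le Me^{-\mu t}\|x\|_X$ for all $t\in[0,\tau]$. Exponentially zero-detectable: there exist $M,\omega>0$ such that for all $x\in X$: $y(\cdot,x)\equiv0$ implies $\|\phi(t,x)\|_X\le Me^{-\omega t}\|x\|_X$ for all $t\ge0$. Lie derivative: $\dot V(x):=\limsup_{\tau\to+0}\frac{V(\phi(\tau,x))-V(x)}{\tau}$ (limsup in the extended real line), provided $t\mapsto V(\phi(t,x))$ is continuous at $t=0$. $V:X\to\mathbb R_+$ is a coercive eOSS Lyapunov function in dissipation form if: (a) there exist $k_1,k_2,p>0$ with $k_1\|x\|_X^p\le V(x)\le k_2\|x\|_X^p$ for all $x\in X$; (b) for every $x\in X$ the map $t\mapsto V(\phi(t,x))$, $t\ge0$, is continuous; (c) there exist $\alpha>0$ and $\sigma\in\mathcal K_\infty$ such that, with $p$ as in (a), $\dot V(x)\le-\alpha\|x\|_X^p+\sigma(\|Cx\|_Y)$ for all $x\in X$. It is a coercive eOSS Lyapunov function in implication form if (a), (b) hold and (c) is replaced by: (c') there exist $\tilde\alpha>0$ and $\chi\in\mathcal K_\infty$ such that, with $p$ as in (a), for every $x\in X$: $\|x\|_X\ge\chi(\|Cx\|_Y)\Rightarrow\dot V(x)\le-\tilde\alpha\|x\|_X^p$. Linear Lyapunov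 gain means that $\sigma$, respectively $\chi$, can be chosen linear. *)

theory Defs
  imports "HOL-Analysis.Analysis"
begin

section \<open>Comparison functions\<close>

text \<open>Functions on the half-line are total functions on the reals; only their values on
  \<open>{0..}\<close> matter.\<close>

definition class_K :: "(real \<Rightarrow> real) set" where
  "class_K = {\<gamma>. \<gamma> ` {0..} \<subseteq> {0..} \<and> continuous_on {0..} \<gamma> \<and> strict_mono_on {0..} \<gamma> \<and> \<gamma> 0 = 0}"

definition class_K_inf :: "(real \<Rightarrow> real) set" where
  "class_K_inf = {\<gamma> \<in> class_K. \<not> bounded (\<gamma> ` {0..})}"

definition class_L :: "(real \<Rightarrow> real) set" where
  "class_L = {\<gamma>. \<gamma> ` {0..} \<subseteq> {0..} \<and> continuous_on {0..} \<gamma> \<and> strict_antimono_on {0..} \<gamma> \<and>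
     (\<gamma> \<longlongrightarrow> 0) at_top}"

definition class_KL :: "(real \<Rightarrow> real \<Rightarrow> real) set" where
  "class_KL = {\<beta>. continuous_on ({0..} \<times> {0..}) (\<lambda>(r, t). \<beta> r t) \<and>
     (\<forall>t\<ge>0. (\<lambda>r. \<beta> r t) \<in> class_K) \<and> (\<forall>r>0. \<beta> r \<in> class_L)}"

definition linear_gain :: "(real \<Rightarrow> real) \<Rightarrow> bool" where
  "linear_gain \<gamma> \<longleftrightarrow> (\<exists>c. \<forall>r\<ge>0. \<gamma> r = c * r)"

section \<open>Strongly continuous semigroups and generators\<close>

text \<open>Only the operators \<open>T t\<close> with \<open>t \<ge> 0\<close> matter.\<close>

definition C0_semigroup :: "(real \<Rightarrow> 'x::banach \<Rightarrow>\<^sub>L 'x) \<Rightarrow> bool" where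
  "C0_semigroup T \<longleftrightarrow> T 0 = id_blinfun \<and> (\<forall>s\<ge>0. \<forall>t\<ge>0. T (s + t) = T s o\<^sub>L T t) \<and>
     (\<forall>x. ((\<lambda>t. T t x) \<longlongrightarrow> x) (at_right 0))"

text \<open>The unbounded operator \<open>A : D \<subset> X \<rightarrow> X\<close> is given by its domain \<open>D\<close> and a total function
  \<open>A\<close> whose values outside \<open>D\<close> are irrelevant.\<close>

definition generates ::
  "'x::banach set \<Rightarrow> ('x \<Rightarrow> 'x) \<Rightarrow> (real \<Rightarrow> 'x \<Rightarrow>\<^sub>L 'x) \<Rightarrow> bool" where
  "generates D A T \<longleftrightarrow> C0_semigroup T \<and>
     D = {x. \<exists>z. ((\<lambda>h. (T h x - x) /\<^sub>R h) \<longlongrightarrow> z) (at_right 0)} \<and>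
     (\<forall>x\<in>D. ((\<lambda>h. (T h x - x) /\<^sub>R h) \<longlongrightarrow> A x) (at_right 0))"

definition unif_exp_stable :: "(real \<Rightarrow> 'x::banach \<Rightarrow>\<^sub>L 'x) \<Rightarrow> bool" where
  "unif_exp_stable S \<longleftrightarrow>
     (\<exists>M>0. \<exists>\<mu>>0. \<forall>x. \<forall>t\<ge>0. norm (S t x) \<le> M * exp (- \<mu> * t) * norm x)"

section \<open>Detectability and output-to-state stability\<close>

definition flow :: "(real \<Rightarrow> 'x::banach \<Rightarrow>\<^sub>L 'x) \<Rightarrow> real \<Rightarrow> 'x \<Rightarrow> 'x" where
  "flow T t x = T t x"

definition outp ::
  "(real \<Rightarrow> 'x::banach \<Rightarrow>\<^sub>L 'x) \<Rightarrow> ('x \<Rightarrow>\<^sub>L 'y::banach) \<Rightarrow> real \<Rightarrow> 'x \<Rightarrow> 'y" where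
  "outp T C t x = C (T t x)"

text \<open>The supremum below is a maximum, since the output is continuous in time.\<close>

definition outp_max ::
  "(real \<Rightarrow> 'x::banach \<Rightarrow>\<^sub>L 'x) \<Rightarrow> ('x \<Rightarrow>\<^sub>L 'y::banach) \<Rightarrow> real \<Rightarrow> 'x \<Rightarrow> real" where
  "outp_max T C t x = (SUP s\<in>{0..t}. norm (outp T C s x))"

text \<open>The bounded perturbation \<open>A + LC\<close> has the same domain \<open>D\<close> as \<open>A\<close>.\<close>

definition exp_detectable ::
  "'x::banach set \<Rightarrow> ('x \<Rightarrow> 'x) \<Rightarrow> ('x \<Rightarrow>\<^sub>L 'y::banach) \<Rightarrow> bool" where
  "exp_detectable D A C \<longleftrightarrow>
     (\<exists>(L :: 'y \<Rightarrow>\<^sub>L 'x) S. generates D (\<lambda>x. A x + L (C x)) S \<and> unif_exp_stable S)"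

definition OSS_gain ::
  "(real \<Rightarrow> 'x::banach \<Rightarrow>\<^sub>L 'x) \<Rightarrow> ('x \<Rightarrow>\<^sub>L 'y::banach) \<Rightarrow> (real \<Rightarrow> real) \<Rightarrow> bool" where
  "OSS_gain T C \<gamma> \<longleftrightarrow> \<gamma> \<in> class_K \<and>
     (\<exists>\<beta>\<in>class_KL. \<forall>x. \<forall>t\<ge>0. norm (flow T t x) \<le> \<beta> (norm x) t + \<gamma> (outp_max T C t x))"

definition OSS :: "(real \<Rightarrow> 'x::banach \<Rightarrow>\<^sub>L 'x) \<Rightarrow> ('x \<Rightarrow>\<^sub>L 'y::banach) \<Rightarrow> bool" where
  "OSS T C \<longleftrightarrow> (\<exists>\<gamma>. OSS_gain T C \<gamma>)"

definition OSS_linear :: "(real \<Rightarrow> 'x::banach \<Rightarrow>\<^sub>L 'x) \<Rightarrow> ('x \<Rightarrow>\<^sub>L 'y::banach) \<Rightarrow> bool" where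
  "OSS_linear T C \<longleftrightarrow> (\<exists>\<gamma>. OSS_gain T C \<gamma> \<and> linear_gain \<gamma>)"

definition eOSS_gain ::
  "(real \<Rightarrow> 'x::banach \<Rightarrow>\<^sub>L 'x) \<Rightarrow> ('x \<Rightarrow>\<^sub>L 'y::banach) \<Rightarrow> (real \<Rightarrow> real) \<Rightarrow> bool" where
  "eOSS_gain T C \<gamma> \<longleftrightarrow> \<gamma> \<in> class_K \<and>
     (\<exists>M>0. \<exists>\<mu>>0. \<forall>x. \<forall>t\<ge>0.
        norm (flow T t x) \<le> M * exp (- \<mu> * t) * norm x + \<gamma> (outp_max T C t x))"

definition eOSS :: "(real \<Rightarrow> 'x::banach \<Rightarrow>\<^sub>L 'x) \<Rightarrow> ('x \<Rightarrow>\<^sub>L 'y::banach) \<Rightarrow> bool" where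
  "eOSS T C \<longleftrightarrow> (\<exists>\<gamma>. eOSS_gain T C \<gamma>)"

definition eOSS_linear :: "(real \<Rightarrow> 'x::banach \<Rightarrow>\<^sub>L 'x) \<Rightarrow> ('x \<Rightarrow>\<^sub>L 'y::banach) \<Rightarrow> bool" where
  "eOSS_linear T C \<longleftrightarrow> (\<exists>\<gamma>. eOSS_gain T C \<gamma> \<and> linear_gain \<gamma>)"

definition UGESMO :: "(real \<Rightarrow> 'x::banach \<Rightarrow>\<^sub>L 'x) \<Rightarrow> ('x \<Rightarrow>\<^sub>L 'y::banach) \<Rightarrow> bool" where
  "UGESMO T C \<longleftrightarrow>
     (\<exists>\<rho>>0. \<exists>M>0. \<exists>\<mu>>0. \<forall>x. \<forall>\<tau>\<ge>0.
        (\<forall>t\<in>{0..\<tau>}. norm (flow T t x) \<ge> \<rho> * norm (outp T C t x)) \<longrightarrow>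
        (\<forall>t\<in>{0..\<tau>}. norm (flow T t x) \<le> M * exp (- \<mu> * t) * norm x))"

definition exp_zero_detectable ::
  "(real \<Rightarrow> 'x::banach \<Rightarrow>\<^sub>L 'x) \<Rightarrow> ('x \<Rightarrow>\<^sub>L 'y::banach) \<Rightarrow> bool" where
  "exp_zero_detectable T C \<longleftrightarrow>
     (\<exists>M>0. \<exists>\<omega>>0. \<forall>x. (\<forall>t\<ge>0. outp T C t x = 0) \<longrightarrow>
        (\<forall>t\<ge>0. norm (flow T t x) \<le> M * exp (- \<omega> * t) * norm x))"

section \<open>Lyapunov functions\<close>

text \<open>The Lie derivative is only used for \<open>V\<close> that are continuous along trajectories.\<close>

definition lie_deriv ::
  "(real \<Rightarrow> 'x::banach \<Rightarrow>\<^sub>L 'x) \<Rightarrow> ('x \<Rightarrow> real) \<Rightarrow> 'x \<Rightarrow> ereal" where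
  "lie_deriv T V x = Limsup (at_right 0) (\<lambda>\<tau>. ereal ((V (flow T \<tau> x) - V x) / \<tau>))"

definition coercive :: "('x::banach \<Rightarrow> real) \<Rightarrow> real \<Rightarrow> bool" where
  "coercive V p \<longleftrightarrow>
     (\<exists>k1>0. \<exists>k2>0. \<forall>x. k1 * norm x powr p \<le> V x \<and> V x \<le> k2 * norm x powr p)"

definition continuous_along_flow ::
  "(real \<Rightarrow> 'x::banach \<Rightarrow>\<^sub>L 'x) \<Rightarrow> ('x \<Rightarrow> real) \<Rightarrow> bool" where
  "continuous_along_flow T V \<longleftrightarrow> (\<forall>x. continuous_on {0..} (\<lambda>t. V (flow T t x)))"

definition eOSS_Lyapunov_dissipation ::
  "(real \<Rightarrow> 'x::banach \<Rightarrow>\<^sub>L 'x) \<Rightarrow> ('x \<Rightarrow>\<^sub>L 'y::banach) \<Rightarrow> ('x \<Rightarrow> real) \<Rightarrow> (real \<Rightarrow> real) \<Rightarrow> bool"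
  where
  "eOSS_Lyapunov_dissipation T C V \<sigma> \<longleftrightarrow> (\<forall>x. 0 \<le> V x) \<and> \<sigma> \<in> class_K_inf \<and>
     (\<exists>p>0. coercive V p \<and> continuous_along_flow T V \<and>
       (\<exists>\<alpha>>0. \<forall>x. lie_deriv T V x \<le> ereal (- \<alpha> * norm x powr p + \<sigma> (norm (C x)))))"

definition eOSS_Lyapunov_implication ::
  "(real \<Rightarrow> 'x::banach \<Rightarrow>\<^sub>L 'x) \<Rightarrow> ('x \<Rightarrow>\<^sub>L 'y::banach) \<Rightarrow> ('x \<Rightarrow> real) \<Rightarrow> (real \<Rightarrow> real) \<Rightarrow> bool"
  where
  "eOSS_Lyapunov_implication T C V \<kappa> \<longleftrightarrow> (\<forall>x. 0 \<le> V x) \<and> \<kappa> \<in> class_K_inf \<and>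
     (\<exists>p>0. coercive V p \<and> continuous_along_flow T V \<and>
       (\<exists>\<alpha>>0. \<forall>x. norm x \<ge> \<kappa> (norm (C x)) \<longrightarrow>
          lie_deriv T V x \<le> ereal (- \<alpha> * norm x powr p)))"

definition has_eOSS_Lyapunov_dissipation_linear ::
  "(real \<Rightarrow> 'x::banach \<Rightarrow>\<^sub>L 'x) \<Rightarrow> ('x \<Rightarrow>\<^sub>L 'y::banach) \<Rightarrow> bool" where
  "has_eOSS_Lyapunov_dissipation_linear T C \<longleftrightarrow>
     (\<exists>V \<sigma>. eOSS_Lyapunov_dissipation T C V \<sigma> \<and> linear_gain \<sigma>)"

definition has_eOSS_Lyapunov_implication_linear ::
  "(real \<Rightarrow> 'x::banach \<Rightarrow>\<^sub>L 'x) \<Rightarrow> ('x \<Rightarrow>\<^sub>L 'y::banach) \<Rightarrow> bool" where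
  "has_eOSS_Lyapunov_implication_linear T C \<longleftrightarrow>
     (\<exists>V \<kappa>. eOSS_Lyapunov_implication T C V \<kappa> \<and> linear_gain \<kappa>)"

end

theory Submission
  imports Defs "HOL-Real_Asymp.Real_Asymp"
begin

text \<open>
  All properties other than detectability, the dissipation form and zero-detectability are equivalent,
  because the system is linear and \<open>\<parallel>T t\<parallel>\<close> is bounded on bounded time intervals. The implications run
  in a cycle.

  \<^item> OSS implies eOSS with linear gain (\<open>OSS_imp_eOSS_linear\<close>). On the unit sphere pick a time \<open>\<tau>\<close> with
    \<open>\<beta> 1 \<tau> < 1/4\<close> and an output level \<open>\<delta>\<close> with \<open>\<gamma> \<delta> < 1/4\<close>. A normalised trajectory whose output stays
    below \<open>\<delta>\<close> halves its norm by time \<open>\<tau>\<close>; one whose output exceeds \<open>\<delta>\<close> is bounded by a multiple of its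
    output. Homogeneity turns this into \<open>\<parallel>T \<tau> x\<parallel> \<le> \<parallel>x\<parallel> / 2 + k max \<parallel>y\<parallel>\<close> for all \<open>x\<close>, and iteration of
    this inequality is exponential decay with a linear gain.

  \<^item> eOSS with linear gain implies UGESMO (\<open>eOSS_linear_imp_UGESMO\<close>) by a small-gain argument: while
    \<open>\<parallel>y\<parallel> \<le> \<parallel>x\<parallel> / \<rho>\<close> with \<open>\<rho>\<close> large, the output term is absorbed and the norm halves again over a fixed time.

  \<^item> UGESMO implies a Lyapunov function in implication form (\<open>UGESMO_imp_implication\<close>). The classical
    candidate, the supremum of \<open>exp (\<mu> * t) * \<parallel>T t x\<parallel>\<close> up to the first time at which the output
    dominates, may jump when a trajectory crosses the boundary of the decay region. Here it is replaced by the
    max-min value of \<open>min (exp (\<mu> * t) * \<parallel>T t x\<parallel>) (inf over s \<le> t of b s)\<close>, in which the sharp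
    stopping time becomes a continuous penalty \<open>b\<close>. This value is as continuous in time as its data, it is
    equivalent to the norm, and it decays at rate \<open>\<mu>\<close> where the penalty is inactive, that is where the
    state dominates the output.

  \<^item> A Lyapunov function in implication form implies eOSS (\<open>Lyapunov_implication_imp_eOSS\<close>), by a
    comparison argument with one-sided upper derivatives.

  The dissipation form is converted into an implication form with a nonlinear gain
  \<open>r \<mapsto> (2 \<sigma> r / \<alpha>) powr (1 / p)\<close>, because the exponent \<open>p\<close> of the Lyapunov function is arbitrary; this still
  gives eOSS, and the cycle above then supplies a possibly different function with linear gain.

  For a detectable system with stable semigroup \<open>S\<close> generated by \<open>A + L C\<close>, the equivalent norm
  \<open>V x = sup exp (\<mu> * t) * \<parallel>S t x\<parallel>\<close> contracts along \<open>S\<close>, and \<open>T\<close> deviates from \<open>S\<close> over a short time \<open>h\<close> by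
  at most a constant times \<open>h * sup \<parallel>L (y s)\<parallel>\<close> (\<open>semigroup_diff_bound\<close>); so \<open>V\<close> is a Lyapunov function in
  dissipation form with \<open>p = 1\<close>.
\<close>

section \<open>One-sided derivatives\<close>

text \<open>Trajectories are differentiated only from the right, so the mean value theorem is replaced by
  this Dini-type criterion. For a slope \<open>\<epsilon> > 0\<close> the last time at which \<open>\<phi> s - \<epsilon> * (s - a)\<close> does not exceed its
  initial value must be \<open>b\<close>, since the hypothesis lets one continue past any earlier time.\<close>

lemma upper_right_derivative_nonpos_imp_le:
  fixes \<phi> :: "real \<Rightarrow> real"
  assumes ab: "a \<le> b" and cont: "continuous_on {a..b} \<phi>"
    and der: "\<And>s \<epsilon>. a \<le> s \<Longrightarrow> s < b \<Longrightarrow> 0 < \<epsilon> \<Longrightarrow> \<forall>\<^sub>F h in at_right 0. \<phi> (s + h) \<le> \<phi> s + \<epsilon> * h"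
  shows "\<phi> b \<le> \<phi> a"
proof -
  have slope: "\<phi> b \<le> \<phi> a + \<epsilon> * (b - a)" if \<epsilon>: "0 < \<epsilon>" for \<epsilon>
  proof -
    define \<psi> where "\<psi> s = \<phi> s - \<epsilon> * (s - a)" for s
    define Z where "Z = {s \<in> {a..b}. \<psi> s \<le> \<psi> a}"
    have "closed Z"
      unfolding Z_def \<psi>_def by (intro continuous_on_closed_Collect_le continuous_intros cont)
    moreover have Z: "Z \<noteq> {}" "bdd_above Z"
      using ab by (auto simp: Z_def intro!: bdd_aboveI[of _ b])
    ultimately have sZ: "Sup Z \<in> Z"
      by (intro closed_contains_Sup)
    have "Sup Z = b"
    proof (rule ccontr)
      assume "Sup Z \<noteq> b"
      then have s: "a \<le> Sup Z" "Sup Z < b" "\<psi> (Sup Z) \<le> \<psi> a"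
        using sZ by (auto simp: Z_def)
      have "\<forall>\<^sub>F h in at_right 0. h \<in> {0<..<b - Sup Z}"
        using s by (intro eventually_at_right_real) auto
      with der[OF s(1,2) \<epsilon>] have "\<forall>\<^sub>F h in at_right 0. 0 < h \<and> Sup Z + h \<in> Z"
      proof eventually_elim
        case (elim h)
        then show ?case
          using s by (auto simp: Z_def \<psi>_def algebra_simps)
      qed
      then obtain h where "0 < h" "Sup Z + h \<in> Z"
        using eventually_happens[of _ "at_right (0::real)"] by auto
      then show False
        using cSup_upper[OF _ Z(2)] by force
    qed
    then show ?thesis
      using sZ by (simp add: Z_def \<psi>_def)
  qed
  show ?thesis
  proof (rule field_le_epsilon)
    fix e :: real assume e: "0 < e"
    have "\<phi> b \<le> \<phi> a + e / (b - a + 1) * (b - a)"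
      using ab e by (intro slope) auto
    also have "\<dots> \<le> \<phi> a + e"
      using ab e by (simp add: field_simps)
    finally show "\<phi> b \<le> \<phi> a + e" .
  qed
qed

text \<open>The criterion applies to \<open>norm (f s - f a) - B * (s - a)\<close>.\<close>

lemma norm_diff_le_of_right_derivative:
  fixes f :: "real \<Rightarrow> 'a::real_normed_vector"
  assumes ab: "a \<le> b" and cont: "continuous_on {a..b} f"
    and der: "\<And>s. a \<le> s \<Longrightarrow> s < b \<Longrightarrow> ((\<lambda>h. (f (s + h) - f s) /\<^sub>R h) \<longlongrightarrow> f' s) (at_right 0)"
    and bound: "\<And>s. a \<le> s \<Longrightarrow> s < b \<Longrightarrow> norm (f' s) \<le> B"
  shows "norm (f b - f a) \<le> B * (b - a)"
proof -
  define \<phi> where "\<phi> s = norm (f s - f a) - B * (s - a)" for s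
  have "\<phi> b \<le> \<phi> a"
  proof (rule upper_right_derivative_nonpos_imp_le[OF ab])
    show "continuous_on {a..b} \<phi>"
      unfolding \<phi>_def by (intro continuous_intros cont)
    fix s \<epsilon> :: real assume s: "a \<le> s" "s < b" and \<epsilon>: "0 < \<epsilon>"
    have "((\<lambda>h. norm ((f (s + h) - f s) /\<^sub>R h)) \<longlongrightarrow> norm (f' s)) (at_right 0)"
      by (intro tendsto_norm der s)
    then have "\<forall>\<^sub>F h in at_right 0. norm ((f (s + h) - f s) /\<^sub>R h) < B + \<epsilon>"
      by (rule order_tendstoD) (use bound[OF s] \<epsilon> in simp)
    moreover have "\<forall>\<^sub>F h :: real in at_right 0. 0 < h"
      by (rule eventually_at_right_less)
    ultimately show "\<forall>\<^sub>F h in at_right 0. \<phi> (s + h) \<le> \<phi> s + \<epsilon> * h"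
    proof eventually_elim
      case (elim h)
      then have "norm (f (s + h) - f s) \<le> (B + \<epsilon>) * h"
        by (simp add: pos_divide_less_eq less_imp_le flip: divide_inverse_commute)
      moreover have "norm (f (s + h) - f a) \<le> norm (f (s + h) - f s) + norm (f s - f a)"
        by (metis norm_triangle_ineq add_diff_eq diff_add_cancel)
      ultimately show ?case
        by (simp add: \<phi>_def algebra_simps)
    qed
  qed
  then show ?thesis
    by (simp add: \<phi>_def)
qed

text \<open>The generator is defined by a limit of right difference quotients, whereas the fundamental theorem
  of calculus speaks of derivatives within an interval.\<close>

lemma has_vector_derivative_imp_right_limit:
  fixes f :: "real \<Rightarrow> 'a::real_normed_vector"
  assumes f: "(f has_vector_derivative d) (at a within {a..b})" and ab: "a < b"
  shows "((\<lambda>h. (f (a + h) - f a) /\<^sub>R h) \<longlongrightarrow> d) (at_right 0)"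
proof -
  have "((\<lambda>y. (f y - f a - (y - a) *\<^sub>R d) /\<^sub>R norm (y - a)) \<longlongrightarrow> 0) (at_right a)"
    using f ab by (simp add: has_vector_derivative_def has_derivative_at_within at_within_Icc_at_right)
  then have "((\<lambda>h. (f (a + h) - f a - h *\<^sub>R d) /\<^sub>R \<bar>h\<bar>) \<longlongrightarrow> 0) (at_right 0)"
    by (simp add: filterlim_at_right_to_0[of _ _ a] add.commute)
  moreover have "\<forall>\<^sub>F h in at_right 0. (f (a + h) - f a - h *\<^sub>R d) /\<^sub>R \<bar>h\<bar> = (f (a + h) - f a) /\<^sub>R h - d"
    using eventually_at_right_less[of "0::real"]
    by eventually_elim (simp add: scaleR_diff_right)
  ultimately have "((\<lambda>h. (f (a + h) - f a) /\<^sub>R h - d) \<longlongrightarrow> 0) (at_right 0)"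
    by (rule Lim_transform_eventually)
  then show ?thesis
    by (rule LIM_zero_cancel)
qed

text \<open>First-order expansions of smooth factors such as \<open>exp (- \<mu> * h)\<close> enter the estimates of Lie
  derivatives in this form.\<close>

lemma eventually_le_of_right_derivative:
  fixes g :: "real \<Rightarrow> real"
  assumes g: "(g has_real_derivative d) (at 0)" and d: "d < d'"
  shows "\<forall>\<^sub>F h in at_right 0. g h \<le> g 0 + d' * h"
proof -
  have "((\<lambda>h. (g h - g 0) / h) \<longlongrightarrow> d) (at_right 0)"
    using DERIV_subset[OF g, of "{0<..}"] by (simp add: has_field_derivative_iff)
  then have "\<forall>\<^sub>F h in at_right 0. (g h - g 0) / h < d'"
    using d by (rule order_tendstoD)
  then show ?thesis
    using eventually_at_right_less[of "0::real"]
    by eventually_elim (simp add: field_simps)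
qed

section \<open>Strongly continuous semigroups\<close>

lemma C0_semigroup_zero [simp]: "C0_semigroup T \<Longrightarrow> T 0 x = x"
  by (simp add: C0_semigroup_def)

lemma C0_semigroup_add:
  "C0_semigroup T \<Longrightarrow> 0 \<le> s \<Longrightarrow> 0 \<le> t \<Longrightarrow> T (s + t) x = T s (T t x)"
  by (simp add: C0_semigroup_def)

lemma C0_semigroup_diff:
  assumes "C0_semigroup T" "0 \<le> s" "s \<le> t"
  shows "T t x = T (t - s) (T s x)"
  using C0_semigroup_add[OF assms(1), of "t - s" s x] assms by simp

text \<open>The uniform boundedness principle at time zero. Strong continuity covers the space by the
  closed sets \<open>E n\<close> of the points whose trajectory stays below \<open>n\<close> up to time \<open>1 / (n + 1)\<close>. By Baire, one
  of them contains a ball, and a bound on a ball is a bound on the operators.\<close>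

lemma C0_semigroup_bounded_near_zero:
  fixes T :: "real \<Rightarrow> 'x::banach \<Rightarrow>\<^sub>L 'x"
  assumes T: "C0_semigroup T"
  obtains \<delta> K where "0 < \<delta>" "1 \<le> K" "\<And>t x. 0 \<le> t \<Longrightarrow> t \<le> \<delta> \<Longrightarrow> norm (T t x) \<le> K * norm x"
proof -
  define E where "E n = {x. \<forall>t\<in>{0..1 / real (Suc n)}. norm (T t x) \<le> real n}" for n
  have closedE: "closed (E n)" for n
    unfolding E_def Ball_def by (intro closed_Collect_all closed_Collect_imp closed_Collect_le continuous_intros) auto
  have "\<exists>n. x \<in> E n" for x
  proof -
    have "((\<lambda>t. T t x) \<longlongrightarrow> x) (at_right 0)"
      using T by (simp add: C0_semigroup_def)
    then have "((\<lambda>t. norm (T t x)) \<longlongrightarrow> norm x) (at_right 0)"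
      by (rule tendsto_norm)
    then have "\<forall>\<^sub>F t in at_right 0. norm (T t x) < norm x + 1"
      by (rule order_tendstoD) simp
    then obtain d where d: "0 < d" "\<And>t. 0 < t \<Longrightarrow> t < d \<Longrightarrow> norm (T t x) < norm x + 1"
      by (auto simp: eventually_at_right_field)
    obtain n where n: "max (1 / d) (norm x + 1) < real n"
      using reals_Archimedean2 by blast
    have "1 / real (Suc n) < d"
      using n d(1) by (simp add: field_simps)
    then have "norm (T t x) \<le> real n" if "t \<in> {0..1 / real (Suc n)}" for t
      using that d(2)[of t] n T by (cases "t = 0") auto
    then show ?thesis
      unfolding E_def by blast
  qed
  then have "\<Union>(range E) = UNIV"
    by blast
  then have "\<exists>n. interior (E n) \<noteq> {}"
    using Baire_category_alt[of "euclidean :: 'x topology" "range E"] closedE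
    by (auto simp: completely_metrizable_space_euclidean image_iff) metis
  then obtain n z r where r: "0 < r" "cball z r \<subseteq> E n"
    by (meson ex_in_conv mem_interior_cball)
  have bound: "norm (T t x) \<le> (2 * real n / r + 1) * norm x" if t: "0 \<le> t" "t \<le> 1 / real (Suc n)" for t x
  proof (cases "x = 0")
    case False
    define u where "u = (r / norm x) *\<^sub>R x"
    have "norm u = r"
      using False r by (simp add: u_def)
    then have "z + u \<in> E n" "z \<in> E n"
      using r by (auto simp: dist_norm intro!: subsetD[OF r(2)])
    then have "norm (T t (z + u)) \<le> real n" "norm (T t z) \<le> real n"
      using t by (auto simp: E_def)
    moreover have "T t u = T t (z + u) - T t z"
      by (simp add: blinfun.add_right)
    ultimately have "norm (T t u) \<le> 2 * real n"
      using norm_triangle_ineq4[of "T t (z + u)" "T t z"] by simp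
    moreover have "norm (T t u) = r / norm x * norm (T t x)"
      using r by (simp add: u_def blinfun.scaleR_right)
    ultimately have "norm (T t x) \<le> 2 * real n / r * norm x"
      using r False by (simp add: field_simps)
    then show ?thesis
      using norm_ge_zero[of x] by (simp only: distrib_right)
  qed simp
  show ?thesis
    by (rule that[OF _ _ bound]) (use r in auto)
qed

lemma C0_semigroup_locally_bounded:
  fixes T :: "real \<Rightarrow> 'x::banach \<Rightarrow>\<^sub>L 'x"
  assumes T: "C0_semigroup T"
  obtains K where "1 \<le> K" "\<And>t x. 0 \<le> t \<Longrightarrow> t \<le> \<tau> \<Longrightarrow> norm (T t x) \<le> K * norm x"
proof -
  obtain \<delta> K where \<delta>: "0 < \<delta>" "1 \<le> K"
      "\<And>t x. 0 \<le> t \<Longrightarrow> t \<le> \<delta> \<Longrightarrow> norm (T t x) \<le> K * norm x"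
    using C0_semigroup_bounded_near_zero[OF T] by blast
  have step: "norm (T t x) \<le> K ^ n * K * norm x" if "0 \<le> t" "t \<le> real (Suc n) * \<delta>" for n t x
    using that
  proof (induction n arbitrary: t x)
    case 0
    then show ?case using \<delta>(3) by simp
  next
    case (Suc n)
    show ?case
    proof (cases "t \<le> \<delta>")
      case True
      have "norm (T t x) \<le> K * norm x"
        using True Suc.prems \<delta>(3) by blast
      also have "\<dots> \<le> K ^ Suc n * K * norm x"
        using \<delta>(2) by (intro mult_right_mono) (use one_le_power[of K "Suc n"] in \<open>auto simp: mult.commute\<close>)
      finally show ?thesis .
    next
      case False
      have "norm (T t x) = norm (T (t - \<delta>) (T \<delta> x))"
        using C0_semigroup_diff[OF T, of \<delta> t x] False \<delta>(1) by simp
      also have "\<dots> \<le> K ^ n * K * norm (T \<delta> x)"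
        using False Suc.prems \<delta>(1) by (intro Suc.IH) (auto simp: algebra_simps)
      also have "\<dots> \<le> K ^ n * K * (K * norm x)"
        using \<delta> by (intro mult_left_mono) auto
      finally show ?thesis by (simp add: algebra_simps)
    qed
  qed
  obtain n where "\<tau> / \<delta> < real n"
    using reals_Archimedean2 by blast
  then have "\<tau> \<le> real (Suc n) * \<delta>"
    using \<delta>(1) by (simp add: field_simps)
  moreover have "1 \<le> K ^ n * K"
    using \<delta>(2) one_le_power[of K "Suc n"] by (simp add: mult.commute)
  ultimately show ?thesis
    using step that by (meson order.trans)
qed

lemma continuous_on_C0_semigroup:
  fixes T :: "real \<Rightarrow> 'x::banach \<Rightarrow>\<^sub>L 'x"
  assumes T: "C0_semigroup T"
  shows "continuous_on {0..} (\<lambda>t. T t x)"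
  unfolding continuous_on_iff
proof safe
  fix t e :: real assume t: "0 \<le> t" and e: "0 < e"
  obtain K where K: "1 \<le> K" "\<And>s x. 0 \<le> s \<Longrightarrow> s \<le> t + 1 \<Longrightarrow> norm (T s x) \<le> K * norm x"
    using C0_semigroup_locally_bounded[OF T] by blast
  have "((\<lambda>h. T h x) \<longlongrightarrow> x) (at_right 0)"
    using T by (simp add: C0_semigroup_def)
  then have "\<forall>\<^sub>F h in at_right 0. dist (T h x) x < e / K"
    using e K(1) by (intro tendstoD) auto
  then obtain d where d: "0 < d" "\<And>h. 0 < h \<Longrightarrow> h < d \<Longrightarrow> dist (T h x) x < e / K"
    by (auto simp: eventually_at_right_field)
  have close: "dist (T v x) (T u x) < e" if "0 \<le> u" "u \<le> v" "u \<le> t + 1" "v - u < d" for u v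
  proof -
    have "T v x - T u x = T u (T (v - u) x - x)"
      using C0_semigroup_add[OF T, of u "v - u" x] that by (simp add: blinfun.diff_right)
    then have "dist (T v x) (T u x) \<le> K * norm (T (v - u) x - x)"
      using K(2)[of u] that by (simp add: dist_norm)
    also have "\<dots> < K * (e / K)"
      using d(2)[of "v - u"] that K e T by (cases "v = u") (auto simp: dist_norm field_simps)
    finally show ?thesis using K by simp
  qed
  show "\<exists>d>0. \<forall>s\<in>{0..}. dist s t < d \<longrightarrow> dist (T s x) (T t x) < e"
  proof (intro exI[of _ d] conjI ballI impI d(1))
    fix s assume "s \<in> {0..}" "dist s t < d"
    then show "dist (T s x) (T t x) < e"
      using close[of s t] close[of t s] t by (cases "s \<le> t") (auto simp: dist_commute dist_real_def)
  qed
qed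

text \<open>Strong convergence and a uniform bound on the operators suffice for joint convergence; a semigroup
  is in general not continuous in the operator norm.\<close>

lemma tendsto_blinfun_apply_bounded:
  fixes G :: "'c \<Rightarrow> 'a::real_normed_vector \<Rightarrow>\<^sub>L 'b::real_normed_vector"
  assumes bound: "\<forall>\<^sub>F y in F. \<forall>v. norm (G y v) \<le> M * norm v"
    and G: "((\<lambda>y. G y z) \<longlongrightarrow> l) F" and w: "(w \<longlongrightarrow> z) F"
  shows "((\<lambda>y. G y (w y)) \<longlongrightarrow> l) F"
proof -
  have "((\<lambda>y. M * norm (w y - z)) \<longlongrightarrow> M * norm (z - z)) F"
    by (intro tendsto_intros w)
  then have "((\<lambda>y. M * norm (w y - z)) \<longlongrightarrow> 0) F"
    by simp
  moreover have "\<forall>\<^sub>F y in F. norm (G y (w y - z)) \<le> M * norm (w y - z)"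
    using bound by (rule eventually_mono) blast
  ultimately have "((\<lambda>y. G y (w y - z)) \<longlongrightarrow> 0) F"
    by (rule Lim_null_comparison[rotated])
  then have "((\<lambda>y. G y (w y - z) + G y z) \<longlongrightarrow> 0 + l) F"
    using G by (rule tendsto_add)
  then show ?thesis
    by (simp add: blinfun.diff_right)
qed

section \<open>Generators and bounded perturbations\<close>

lemma generates_C0_semigroup: "generates D A T \<Longrightarrow> C0_semigroup T"
  by (simp add: generates_def)

lemma generates_right_derivative:
  "generates D A T \<Longrightarrow> x \<in> D \<Longrightarrow> ((\<lambda>h. (T h x - x) /\<^sub>R h) \<longlongrightarrow> A x) (at_right 0)"
  by (simp add: generates_def)

lemma generates_domain_iff:
  "generates D A T \<Longrightarrow> x \<in> D \<longleftrightarrow> (\<exists>z. ((\<lambda>h. (T h x - x) /\<^sub>R h) \<longlongrightarrow> z) (at_right 0))"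
  by (auto simp: generates_def)

lemma generator_domain_invariant:
  assumes gen: "generates D A T" and x: "x \<in> D" and s: "0 \<le> s"
  shows "T s x \<in> D"
proof -
  note T = generates_C0_semigroup[OF gen]
  have "((\<lambda>h. T s ((T h x - x) /\<^sub>R h)) \<longlongrightarrow> T s (A x)) (at_right 0)"
    by (intro tendsto_intros generates_right_derivative[OF gen x])
  moreover have "\<forall>\<^sub>F h in at_right 0. T s ((T h x - x) /\<^sub>R h) = (T h (T s x) - T s x) /\<^sub>R h"
    using eventually_at_right_less[of "0::real"]
  proof eventually_elim
    case (elim h)
    have "T s (T h x) = T h (T s x)"
      using C0_semigroup_add[OF T, of s h x] C0_semigroup_add[OF T, of h s x] elim s
      by (simp add: add.commute)
    then show ?case
      by (simp add: blinfun.scaleR_right blinfun.diff_right)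
  qed
  ultimately have "((\<lambda>h. (T h (T s x) - T s x) /\<^sub>R h) \<longlongrightarrow> T s (A x)) (at_right 0)"
    by (rule Lim_transform_eventually)
  then show ?thesis
    using generates_domain_iff[OF gen] by blast
qed

text \<open>The averages \<open>(1 / h) * integral of T s x over {0..h}\<close> converge to \<open>x\<close>, and they lie in the domain
  because \<open>T \<tau>\<close> maps the integral over \<open>{0..h}\<close> to the one over \<open>{\<tau>..\<tau> + h}\<close>, whose difference quotient in
  \<open>\<tau>\<close> converges.\<close>

lemma generator_domain_dense:
  fixes T :: "real \<Rightarrow> 'x::banach \<Rightarrow>\<^sub>L 'x"
  assumes gen: "generates D A T"
  shows "closure D = UNIV"
proof -
  note T = generates_C0_semigroup[OF gen]
  have "x \<in> closure D" for x
  proof -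
    define I where "I u = integral {0..u} (\<lambda>s. T s x)" for u
    have cont: "continuous_on {0..b} (\<lambda>s. T s x)" for b
      by (rule continuous_on_subset[OF continuous_on_C0_semigroup[OF T]]) auto
    have I_deriv: "(I has_vector_derivative T u x) (at u within {0..b})" if "0 \<le> u" "u \<le> b" for u b
      unfolding I_def using that by (intro integral_has_vector_derivative cont) auto
    have I_deriv_right: "((\<lambda>h. (I (u + h) - I u) /\<^sub>R h) \<longlongrightarrow> T u x) (at_right 0)" if "0 \<le> u" for u
      by (rule has_vector_derivative_imp_right_limit[where b = "u + 1"])
        (use that in \<open>auto intro!: has_vector_derivative_within_subset[OF I_deriv[of u "u + 1"]]\<close>)
    have T_I: "T \<tau> (I h) = I (\<tau> + h) - I \<tau>" if \<tau>: "0 \<le> \<tau>" and h: "0 \<le> h" for \<tau> h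
    proof -
      have "((\<lambda>s. T (\<tau> + s) x) has_integral I (\<tau> + h) - I (\<tau> + 0)) {0..h}"
      proof (rule fundamental_theorem_of_calculus[OF h])
        fix s assume s: "s \<in> {0..h}"
        have "((I \<circ> (\<lambda>s. \<tau> + s)) has_vector_derivative 1 *\<^sub>R T (\<tau> + s) x) (at s within {0..h})"
          by (rule vector_diff_chain_within)
            (use s \<tau> h in \<open>auto intro!: derivative_eq_intros has_vector_derivative_within_subset[OF I_deriv[of "\<tau> + s" "\<tau> + h"]]\<close>)
        then show "((\<lambda>s. I (\<tau> + s)) has_vector_derivative T (\<tau> + s) x) (at s within {0..h})"
          by (simp add: o_def)
      qed
      moreover have "((T \<tau> \<circ> (\<lambda>s. T s x)) has_integral T \<tau> (I h)) {0..h}"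
        unfolding I_def
        by (intro has_integral_linear integrable_integral integrable_continuous_real cont
            blinfun.bounded_linear_right)
      then have "((\<lambda>s. T (\<tau> + s) x) has_integral T \<tau> (I h)) {0..h}"
        by (rule has_integral_eq[rotated]) (use C0_semigroup_add[OF T \<tau>] in auto)
      ultimately have "I (\<tau> + h) - I (\<tau> + 0) = T \<tau> (I h)"
        by (rule has_integral_unique)
      then show ?thesis
        by simp
    qed
    have I_D: "I h /\<^sub>R h \<in> D" if h: "0 < h" for h
    proof -
      have "((\<lambda>\<tau>. ((I (h + \<tau>) - I h) /\<^sub>R \<tau> - (I (0 + \<tau>) - I 0) /\<^sub>R \<tau>) /\<^sub>R h) \<longlongrightarrow> (T h x - T 0 x) /\<^sub>R h) (at_right 0)"
        using h by (intro tendsto_intros I_deriv_right) auto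
      moreover have "\<forall>\<^sub>F \<tau> in at_right 0. ((I (h + \<tau>) - I h) /\<^sub>R \<tau> - (I (0 + \<tau>) - I 0) /\<^sub>R \<tau>) /\<^sub>R h
          = (T \<tau> (I h /\<^sub>R h) - I h /\<^sub>R h) /\<^sub>R \<tau>"
        using eventually_at_right_less[of "0::real"]
      proof eventually_elim
        case (elim \<tau>)
        moreover have "I 0 = 0"
          by (simp add: I_def)
        ultimately show ?case
          using h by (simp add: blinfun.scaleR_right T_I algebra_simps)
      qed
      ultimately show ?thesis
        unfolding generates_domain_iff[OF gen] by (blast intro: Lim_transform_eventually)
    qed
    have "((\<lambda>h. I h /\<^sub>R h) \<longlongrightarrow> x) (at_right 0)"
      using I_deriv_right[of 0] T by (simp add: I_def)
    moreover have "\<forall>\<^sub>F h in at_right 0. I h /\<^sub>R h \<in> closure D"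
      using eventually_at_right_less[of "0::real"]
      by eventually_elim (use I_D closure_subset in blast)
    ultimately show ?thesis
      by (intro Lim_in_closed_set[of "closure D"]) auto
  qed
  then show ?thesis by blast
qed

text \<open>The path \<open>s \<mapsto> S (t - s) (T s x)\<close> leads from \<open>S t x\<close> to \<open>T t x\<close> with right derivative
  \<open>- S (t - s) (B (T s x))\<close>: the unbounded parts of the two generators cancel. This is the variation of
  constants formula in the form of a norm estimate.\<close>

lemma semigroup_diff_bound_on_domain:
  fixes B :: "'x::banach \<Rightarrow>\<^sub>L 'x"
  assumes genT: "generates D A T" and genS: "generates D (\<lambda>x. A x + B x) S"
    and S_bound: "\<And>t x. 0 \<le> t \<Longrightarrow> norm (S t x) \<le> M * norm x" and M: "0 \<le> M"
    and t: "0 \<le> t" and x: "x \<in> D"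
    and b: "\<And>s. 0 \<le> s \<Longrightarrow> s \<le> t \<Longrightarrow> norm (B (T s x)) \<le> b"
  shows "norm (T t x - S t x) \<le> M * b * t"
proof -
  note T = generates_C0_semigroup[OF genT] and S = generates_C0_semigroup[OF genS]
  define f where "f s = S (t - s) (T s x)" for s
  have S_cont: "continuous_on {0..t} (\<lambda>s. S (t - s) z)" for z
    by (rule continuous_on_compose2[OF continuous_on_C0_semigroup[OF S]]) (auto intro!: continuous_intros)
  have "norm (f t - f 0) \<le> M * b * (t - 0)"
  proof (rule norm_diff_le_of_right_derivative[OF t, where f' = "\<lambda>s. S (t - s) (- B (T s x))"])
    show "continuous_on {0..t} f"
      unfolding continuous_on_def f_def
    proof
      fix s assume s: "s \<in> {0..t}"
      show "((\<lambda>s. S (t - s) (T s x)) \<longlongrightarrow> S (t - s) (T s x)) (at s within {0..t})"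
      proof (rule tendsto_blinfun_apply_bounded)
        show "\<forall>\<^sub>F s in at s within {0..t}. \<forall>v. norm (S (t - s) v) \<le> M * norm v"
          by (auto simp: eventually_at_filter S_bound)
        show "((\<lambda>r. S (t - r) (T s x)) \<longlongrightarrow> S (t - s) (T s x)) (at s within {0..t})"
          using S_cont s by (auto simp: continuous_on_def)
        have "continuous_on {0..t} (\<lambda>s. T s x)"
          by (rule continuous_on_subset[OF continuous_on_C0_semigroup[OF T]]) auto
        then show "((\<lambda>s. T s x) \<longlongrightarrow> T s x) (at s within {0..t})"
          using s by (auto simp: continuous_on_def)
      qed
    qed
  next
    fix s assume s: "0 \<le> s" "s < t"
    have D: "T s x \<in> D"
      by (rule generator_domain_invariant[OF genT x s(1)])
    define w where "w h = (T h (T s x) - T s x) /\<^sub>R h - (S h (T s x) - T s x) /\<^sub>R h" for h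
    have h_small: "\<forall>\<^sub>F h in at_right 0. h \<in> {0<..<t - s}"
      using s by (intro eventually_at_right_real) auto
    have "(w \<longlongrightarrow> A (T s x) - (A (T s x) + B (T s x))) (at_right 0)"
      unfolding w_def
      by (intro tendsto_diff generates_right_derivative[OF genT D] generates_right_derivative[OF genS D])
    then have w: "(w \<longlongrightarrow> - B (T s x)) (at_right 0)"
      by simp
    have "((\<lambda>h. S (t - s - h) (w h)) \<longlongrightarrow> S (t - s) (- B (T s x))) (at_right 0)"
    proof (rule tendsto_blinfun_apply_bounded[OF _ _ w])
      show "\<forall>\<^sub>F h in at_right 0. \<forall>v. norm (S (t - s - h) v) \<le> M * norm v"
        using h_small by eventually_elim (auto simp: S_bound)
      have "continuous_on {0..t - s} (\<lambda>h. S (t - s - h) (- B (T s x)))"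
        by (rule continuous_on_compose2[OF continuous_on_C0_semigroup[OF S]]) (auto intro!: continuous_intros)
      then show "((\<lambda>h. S (t - s - h) (- B (T s x))) \<longlongrightarrow> S (t - s) (- B (T s x))) (at_right 0)"
        using s by (auto simp: continuous_on_def at_within_Icc_at_right dest!: bspec[of _ _ 0])
    qed
    moreover have "\<forall>\<^sub>F h in at_right 0. S (t - s - h) (w h) = (f (s + h) - f s) /\<^sub>R h"
      using h_small
    proof eventually_elim
      case (elim h)
      have "f (s + h) = S (t - s - h) (T h (T s x))"
        using C0_semigroup_add[OF T, of h s x] elim s by (simp add: f_def add.commute diff_diff_eq)
      moreover have "f s = S (t - s - h) (S h (T s x))"
        using C0_semigroup_add[OF S, of "t - s - h" h "T s x"] elim s by (simp add: f_def)
      ultimately show ?case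
        by (simp add: w_def blinfun.diff_right blinfun.scaleR_right scaleR_diff_right)
    qed
    ultimately show "((\<lambda>h. (f (s + h) - f s) /\<^sub>R h) \<longlongrightarrow> S (t - s) (- B (T s x))) (at_right 0)"
      by (rule Lim_transform_eventually)
    have "norm (S (t - s) (- B (T s x))) \<le> M * norm (- B (T s x))"
      using s by (intro S_bound) auto
    also have "\<dots> \<le> M * b"
      using b[of s] s M by (intro mult_left_mono) auto
    finally show "norm (S (t - s) (- B (T s x))) \<le> M * b" .
  qed
  then show ?thesis
    using T S by (simp add: f_def)
qed

text \<open>Both sides are continuous in \<open>x\<close>, so the estimate passes from the dense domain to all initial
  states.\<close>

lemma semigroup_diff_bound:
  fixes B :: "'x::banach \<Rightarrow>\<^sub>L 'x"
  assumes genT: "generates D A T" and genS: "generates D (\<lambda>x. A x + B x) S"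
    and S_bound: "\<And>t x. 0 \<le> t \<Longrightarrow> norm (S t x) \<le> M * norm x" and M: "0 \<le> M"
    and t: "0 \<le> t"
    and b: "\<And>s. 0 \<le> s \<Longrightarrow> s \<le> t \<Longrightarrow> norm (B (T s x)) \<le> b"
  shows "norm (T t x - S t x) \<le> M * b * t"
proof -
  obtain K where K: "\<And>s x. 0 \<le> s \<Longrightarrow> s \<le> t \<Longrightarrow> norm (T s x) \<le> K * norm x"
    using C0_semigroup_locally_bounded[OF generates_C0_semigroup[OF genT], of t] by metis
  obtain X where X: "\<And>n. X n \<in> D" "X \<longlonglongrightarrow> x"
    using generator_domain_dense[OF genT] closure_sequential[of x D] by (metis UNIV_I)
  have "norm (T t (X n) - S t (X n)) \<le> M * (b + norm B * (K * norm (X n - x))) * t" for n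
  proof (rule semigroup_diff_bound_on_domain[OF genT genS S_bound M t X(1)])
    fix s assume s: "0 \<le> s" "s \<le> t"
    have "B (T s (X n)) = B (T s x) + B (T s (X n - x))"
      by (simp add: blinfun.diff_right)
    then have "norm (B (T s (X n))) \<le> norm (B (T s x)) + norm (B (T s (X n - x)))"
      by (metis norm_triangle_ineq)
    also have "\<dots> \<le> b + norm B * norm (T s (X n - x))"
      using b[OF s] norm_blinfun by (intro add_mono)
    also have "\<dots> \<le> b + norm B * (K * norm (X n - x))"
      using K[OF s] by (intro add_left_mono mult_left_mono) auto
    finally show "norm (B (T s (X n))) \<le> b + norm B * (K * norm (X n - x))" .
  qed
  moreover have lim: "(\<lambda>n. norm (T t (X n) - S t (X n))) \<longlonglongrightarrow> norm (T t x - S t x)"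
      "(\<lambda>n. M * (b + norm B * (K * norm (X n - x))) * t)
        \<longlonglongrightarrow> M * (b + norm B * (K * norm (x - x))) * t"
    by (intro tendsto_intros X(2))+
  ultimately have "norm (T t x - S t x) \<le> M * (b + norm B * (K * norm (x - x))) * t"
    by (intro LIMSEQ_le[OF lim] exI allI impI)
  then show ?thesis
    by simp
qed

section \<open>Comparison functions and outputs\<close>

lemma powr_le_imp_le:
  fixes a b p :: real
  assumes "0 < p" "0 \<le> b" "a powr p \<le> b powr p"
  shows "a \<le> b"
  using assms powr_less_mono2[of p b a] by (meson not_le)

lemma class_K_nonneg: "\<gamma> \<in> class_K \<Longrightarrow> 0 \<le> r \<Longrightarrow> 0 \<le> \<gamma> r"
  by (auto simp: class_K_def)

lemma class_K_mono: "\<gamma> \<in> class_K \<Longrightarrow> 0 \<le> r \<Longrightarrow> r \<le> s \<Longrightarrow> \<gamma> r \<le> \<gamma> s"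
  by (cases "r = s") (auto simp: class_K_def strict_mono_on_def less_imp_le)

lemma class_K_scale:
  assumes "\<gamma> \<in> class_K" "0 < c"
  shows "(\<lambda>r. c * \<gamma> r) \<in> class_K"
  using assms by (auto simp: class_K_def strict_mono_on_def intro!: continuous_intros)

lemma class_K_powr:
  assumes \<gamma>: "\<gamma> \<in> class_K" and p: "0 < p"
  shows "(\<lambda>r. \<gamma> r powr p) \<in> class_K"
  unfolding class_K_def
proof (intro CollectI conjI)
  show "continuous_on {0..} (\<lambda>r. \<gamma> r powr p)"
    using \<gamma> p by (intro continuous_on_powr') (auto simp: class_K_def intro!: continuous_intros)
  show "strict_mono_on {0..} (\<lambda>r. \<gamma> r powr p)"
    using \<gamma> p by (intro strict_mono_onI powr_less_mono2) (auto simp: class_K_def strict_mono_on_def)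
qed (use \<gamma> in \<open>auto simp: class_K_def\<close>)

lemma linear_in_class_K_inf:
  assumes c: "0 < c"
  shows "(\<lambda>r. c * r) \<in> class_K_inf"
proof -
  have "\<not> bounded ((\<lambda>r. c * r) ` {0..})"
  proof
    assume "bounded ((\<lambda>r. c * r) ` {0..})"
    then obtain a where a: "\<And>r. 0 \<le> r \<Longrightarrow> \<bar>c * r\<bar> \<le> a"
      by (auto simp: bounded_iff)
    from a[of "(\<bar>a\<bar> + 1) / c"] show False
      using c by simp
  qed
  then show ?thesis
    using c by (auto simp: class_K_inf_def class_K_def strict_mono_on_def intro!: continuous_intros)
qed

lemma linear_in_class_K: "0 < c \<Longrightarrow> (\<lambda>r. c * r) \<in> class_K"
  using linear_in_class_K_inf[of c] by (simp add: class_K_inf_def)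

lemma exp_in_class_KL:
  assumes M: "0 < M" and \<mu>: "0 < \<mu>"
  shows "(\<lambda>r t. M * exp (- \<mu> * t) * r) \<in> class_KL"
proof -
  have "((\<lambda>t. exp (- \<mu> * t)) \<longlongrightarrow> 0) at_top"
    using \<mu> by real_asymp
  then have "((\<lambda>t. M * exp (- \<mu> * t) * r) \<longlongrightarrow> M * 0 * r) at_top" for r
    by (intro tendsto_mult tendsto_const)
  then have "(\<lambda>t. M * exp (- \<mu> * t) * r) \<in> class_L" if "0 < r" for r
    using that M \<mu> by (auto simp: class_L_def monotone_on_def intro!: continuous_intros)
  moreover have "(\<lambda>r. M * exp (- \<mu> * t) * r) \<in> class_K" for t
    using M by (intro linear_in_class_K) simp
  ultimately show ?thesis
    by (auto simp: class_KL_def case_prod_beta intro!: continuous_intros)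
qed

lemma continuous_on_outp:
  assumes T: "C0_semigroup T"
  shows "continuous_on {0..} (\<lambda>t. outp T C t x)"
  unfolding outp_def by (intro continuous_intros continuous_on_C0_semigroup[OF T])

lemma bdd_above_outp:
  assumes T: "C0_semigroup T"
  shows "bdd_above ((\<lambda>s. norm (outp T C s x)) ` {0..t})"
proof -
  have "continuous_on {0..t} (\<lambda>s. norm (outp T C s x))"
    by (intro continuous_intros continuous_on_subset[OF continuous_on_outp[OF T]]) auto
  then show ?thesis
    by (intro bounded_imp_bdd_above compact_imp_bounded compact_continuous_image) auto
qed

lemma norm_outp_le_outp_max:
  "C0_semigroup T \<Longrightarrow> 0 \<le> s \<Longrightarrow> s \<le> t \<Longrightarrow> norm (outp T C s x) \<le> outp_max T C t x"
  unfolding outp_max_def by (rule cSUP_upper[OF _ bdd_above_outp]) auto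

lemma outp_max_nonneg: "C0_semigroup T \<Longrightarrow> 0 \<le> t \<Longrightarrow> 0 \<le> outp_max T C t x"
  using norm_outp_le_outp_max[of T 0 t C x] norm_ge_zero order_trans by blast

lemma outp_max_le_iff:
  "C0_semigroup T \<Longrightarrow> 0 \<le> t \<Longrightarrow>
    outp_max T C t x \<le> c \<longleftrightarrow> (\<forall>s\<in>{0..t}. norm (outp T C s x) \<le> c)"
  unfolding outp_max_def by (rule cSUP_le_iff[OF _ bdd_above_outp]) auto

section \<open>Lie derivatives\<close>

text \<open>The estimates of Lie derivatives are made on real increments of \<open>V\<close>; this is the link to the
  extended real upper limit.\<close>

lemma lie_deriv_le_iff:
  "lie_deriv T V x \<le> ereal l \<longleftrightarrow>
    (\<forall>\<epsilon>>0. \<forall>\<^sub>F h in at_right 0. V (T h x) \<le> V x + (l + \<epsilon>) * h)"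
  (is "?L \<longleftrightarrow> ?R")
proof
  assume L: ?L
  show ?R
  proof (intro allI impI)
    fix \<epsilon> :: real assume "0 < \<epsilon>"
    then have "lie_deriv T V x < ereal (l + \<epsilon>)"
      using L by (simp add: le_less_trans)
    then have "\<forall>\<^sub>F h in at_right 0. ereal ((V (flow T h x) - V x) / h) < ereal (l + \<epsilon>)"
      unfolding lie_deriv_def by (rule Limsup_lessD)
    then show "\<forall>\<^sub>F h in at_right 0. V (T h x) \<le> V x + (l + \<epsilon>) * h"
      using eventually_at_right_less[of "0::real"]
      by eventually_elim (simp add: flow_def field_simps)
  qed
next
  assume R: ?R
  have bound: "lie_deriv T V x \<le> ereal (l + \<epsilon>)" if "0 < \<epsilon>" for \<epsilon>
    unfolding lie_deriv_def
  proof (rule Limsup_bounded)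
    show "\<forall>\<^sub>F h in at_right 0. ereal ((V (flow T h x) - V x) / h) \<le> ereal (l + \<epsilon>)"
      using R[rule_format, OF that] eventually_at_right_less[of "0::real"]
      by eventually_elim (simp add: flow_def field_simps)
  qed
  show ?L
  proof (rule ereal_le_epsilon2)
    fix e :: real assume "0 < e"
    then show "lie_deriv T V x \<le> ereal l + ereal e"
      using bound by simp
  qed
qed

section \<open>Detectability\<close>

text \<open>\<open>V\<close> is the equivalent norm \<open>sup exp (\<mu> * t) * \<parallel>S t x\<parallel>\<close>, which satisfies \<open>V (S h x) \<le> exp (- \<mu> * h) * V x\<close>.
  Replacing \<open>S h x\<close> by \<open>T h x\<close> costs \<open>M * (M * h * \<parallel>L y\<parallel>)\<close> up to \<open>o(h)\<close>: one factor \<open>M\<close> is the Lipschitz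
  constant of \<open>V\<close>, the other the bound on \<open>S\<close>.\<close>

lemma exp_detectable_imp_dissipation:
  fixes T :: "real \<Rightarrow> 'x::banach \<Rightarrow>\<^sub>L 'x" and C :: "'x \<Rightarrow>\<^sub>L 'y::banach"
  assumes gen: "generates D A T" and det: "exp_detectable D A C"
  shows "has_eOSS_Lyapunov_dissipation_linear T C"
proof -
  note T = generates_C0_semigroup[OF gen]
  obtain L :: "'y \<Rightarrow>\<^sub>L 'x" and S M \<mu> where genS: "generates D (\<lambda>x. A x + L (C x)) S"
    and M: "0 < M" and \<mu>: "0 < \<mu>"
    and S_decay: "\<And>x t. 0 \<le> t \<Longrightarrow> norm (S t x) \<le> M * exp (- \<mu> * t) * norm x"
    using det by (auto simp: exp_detectable_def unif_exp_stable_def)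
  note S = generates_C0_semigroup[OF genS]
  have S_bound: "norm (S t x) \<le> M * norm x" if "0 \<le> t" for t x
  proof -
    have "M * exp (- \<mu> * t) * norm x \<le> M * 1 * norm x"
      using that M \<mu> by (intro mult_right_mono mult_left_mono) auto
    then show ?thesis
      using S_decay[OF that, of x] by simp
  qed
  define V where "V x = (SUP t\<in>{0..}. exp (\<mu> * t) * norm (S t x))" for x
  have weighted: "exp (\<mu> * t) * norm (S t x) \<le> M * norm x" if "0 \<le> t" for t x
    using mult_left_mono[OF S_decay[OF that, of x], of "exp (\<mu> * t)"]
    by (simp add: exp_minus field_simps)
  have V_upper: "exp (\<mu> * t) * norm (S t x) \<le> V x" if "0 \<le> t" for t x
    unfolding V_def by (rule cSUP_upper) (use that weighted in \<open>auto intro!: bdd_aboveI2\<close>)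
  have V_least: "V x \<le> c" if "\<And>t. 0 \<le> t \<Longrightarrow> exp (\<mu> * t) * norm (S t x) \<le> c" for x c
    unfolding V_def using that by (intro cSUP_least) auto
  have V_ge: "norm x \<le> V x" for x
    using V_upper[of 0 x] S by simp
  have V_le: "V x \<le> M * norm x" for x
    by (intro V_least weighted)
  have V_add: "V (x + y) \<le> V x + M * norm y" for x y
  proof (rule V_least)
    fix t :: real assume t: "0 \<le> t"
    have "exp (\<mu> * t) * norm (S t (x + y)) \<le> exp (\<mu> * t) * norm (S t x) + exp (\<mu> * t) * norm (S t y)"
      by (simp add: blinfun.add_right norm_triangle_ineq flip: distrib_left)
    also have "\<dots> \<le> V x + M * norm y"
      by (intro add_mono V_upper weighted t)
    finally show "exp (\<mu> * t) * norm (S t (x + y)) \<le> V x + M * norm y" .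
  qed
  have V_S: "V (S h x) \<le> exp (- \<mu> * h) * V x" if h: "0 \<le> h" for h x
  proof (rule V_least)
    fix t :: real assume t: "0 \<le> t"
    have "exp (\<mu> * t) * norm (S t (S h x)) = exp (- \<mu> * h) * (exp (\<mu> * (t + h)) * norm (S (t + h) x))"
      using C0_semigroup_add[OF S t h] by (simp add: distrib_left exp_add exp_minus field_simps)
    also have "\<dots> \<le> exp (- \<mu> * h) * V x"
      using t h by (intro mult_left_mono V_upper) auto
    finally show "exp (\<mu> * t) * norm (S t (S h x)) \<le> exp (- \<mu> * h) * V x" .
  qed
  have V_cont: "continuous_on UNIV V"
  proof (rule lipschitz_on_continuous_on, rule lipschitz_onI)
    fix x y
    have "V x \<le> V y + M * norm (x - y)" "V y \<le> V x + M * norm (y - x)"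
      using V_add[of y "x - y"] V_add[of x "y - x"] by simp_all
    then show "dist (V x) (V y) \<le> M * dist x y"
      by (simp add: dist_norm norm_minus_commute abs_le_iff)
  qed (use M in simp)
  \<comment> \<open>the summand 1 makes the gain strictly increasing even if \<open>L = 0\<close>\<close>
  define c where "c = M * M * norm L + 1"
  have c: "0 < c"
    using M by (simp add: c_def add_nonneg_pos)
  have diss: "lie_deriv T V x \<le> ereal (- \<mu> * norm x + c * norm (C x))" for x
    unfolding lie_deriv_le_iff
  proof (intro allI impI)
    fix \<epsilon> :: real assume \<epsilon>: "0 < \<epsilon>"
    define \<eta> where "\<eta> = \<epsilon> / 2 / (M * M)"
    have \<eta>: "0 < \<eta>" "M * M * \<eta> = \<epsilon> / 2"
      using M \<epsilon> by (auto simp: \<eta>_def)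
    define b where "b = norm L * norm (C x) + \<eta>"
    have "((\<lambda>t. T t x) \<longlongrightarrow> x) (at_right 0)"
      using T by (simp add: C0_semigroup_def)
    then have "((\<lambda>t. norm (L (C (T t x)))) \<longlongrightarrow> norm (L (C x))) (at_right 0)"
      by (intro tendsto_intros)
    moreover have "norm (L (C x)) < b"
      using norm_blinfun[of L "C x"] \<eta> by (simp add: b_def)
    ultimately have "\<forall>\<^sub>F t in at_right 0. norm (L (C (T t x))) < b"
      by (rule order_tendstoD)
    then obtain \<delta> where \<delta>: "0 < \<delta>" "\<And>t. 0 < t \<Longrightarrow> t < \<delta> \<Longrightarrow> norm (L (C (T t x))) < b"
      by (auto simp: eventually_at_right_field)
    have "\<forall>\<^sub>F h in at_right 0. h \<in> {0<..<\<delta>}"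
      using \<delta>(1) by (intro eventually_at_right_real) auto
    moreover have "\<forall>\<^sub>F h in at_right 0. exp (- \<mu> * h) * V x \<le> exp (- \<mu> * 0) * V x + (- \<mu> * V x + \<epsilon> / 2) * h"
      by (rule eventually_le_of_right_derivative[where d = "- \<mu> * V x"])
        (use \<epsilon> in \<open>auto intro!: derivative_eq_intros\<close>)
    ultimately show "\<forall>\<^sub>F h in at_right 0. V (T h x) \<le> V x + (- \<mu> * norm x + c * norm (C x) + \<epsilon>) * h"
    proof eventually_elim
      case (elim h)
      have "norm (T h x - S h x) \<le> M * b * h"
      proof (rule semigroup_diff_bound[OF gen, where B = "L o\<^sub>L C"])
        fix s assume s: "0 \<le> s" "s \<le> h"
        show "norm ((L o\<^sub>L C) (T s x)) \<le> b"
          using \<delta>(2)[of s] s elim \<open>norm (L (C x)) < b\<close> T by (cases "s = 0") auto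
      qed (use genS S_bound M elim in auto)
      then have "M * norm (T h x - S h x) \<le> M * (M * b * h)"
        using M by simp
      then have "V (T h x) \<le> exp (- \<mu> * h) * V x + M * (M * b * h)"
        using V_add[of "S h x" "T h x - S h x"] V_S[of h x] elim by simp
      also have "\<dots> \<le> V x + (- \<mu> * V x + \<epsilon> / 2) * h + M * (M * b * h)"
        using elim by simp
      also have "M * (M * b * h) = (M * M * norm L * norm (C x) + M * M * \<eta>) * h"
        by (simp add: b_def algebra_simps)
      also have "V x + (- \<mu> * V x + \<epsilon> / 2) * h + (M * M * norm L * norm (C x) + M * M * \<eta>) * h
          = V x + (- \<mu> * V x + M * M * norm L * norm (C x) + \<epsilon>) * h"
        unfolding \<eta>(2) by (simp add: algebra_simps)
      also have "\<dots> \<le> V x + (- \<mu> * norm x + c * norm (C x) + \<epsilon>) * h"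
        using elim mult_left_mono[OF V_ge[of x], of \<mu>] \<mu>
        by (intro add_left_mono mult_right_mono) (auto simp: c_def algebra_simps add_increasing2)
      finally show ?case .
    qed
  qed
  have "coercive V 1"
    unfolding coercive_def using V_ge V_le M by (intro exI[of _ 1] conjI exI[of _ M]) auto
  moreover have "continuous_along_flow T V"
    unfolding continuous_along_flow_def flow_def
    by (intro allI continuous_on_compose2[OF V_cont] continuous_on_C0_semigroup T) auto
  moreover have "0 \<le> V x" for x
    using V_ge[of x] norm_ge_zero order_trans by blast
  moreover have "lie_deriv T V x \<le> ereal (- \<mu> * norm x powr 1 + c * norm (C x))" for x
    using diss by simp
  ultimately have "eOSS_Lyapunov_dissipation T C V (\<lambda>r. c * r)"
    unfolding eOSS_Lyapunov_dissipation_def using linear_in_class_K_inf[OF c] \<mu> zero_less_one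
    by blast
  then show ?thesis
    unfolding has_eOSS_Lyapunov_dissipation_linear_def linear_gain_def by blast
qed

section \<open>Lyapunov functions imply output-to-state stability\<close>

text \<open>The weighted function \<open>exp (\<mu> * s) * W s\<close> is nonincreasing by the one-sided criterion.\<close>

lemma le_exp_of_right_derivative:
  fixes W :: "real \<Rightarrow> real"
  assumes t: "0 \<le> t" and cont: "continuous_on {0..t} W"
    and der: "\<And>s \<epsilon>. 0 \<le> s \<Longrightarrow> s < t \<Longrightarrow> 0 < \<epsilon> \<Longrightarrow>
      \<forall>\<^sub>F h in at_right 0. W (s + h) \<le> W s + (- \<mu> * W s + \<epsilon>) * h"
  shows "W t \<le> exp (- \<mu> * t) * W 0"
proof -
  define \<phi> where "\<phi> s = exp (\<mu> * s) * W s" for s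
  have "\<phi> t \<le> \<phi> 0"
  proof (rule upper_right_derivative_nonpos_imp_le[OF t])
    show "continuous_on {0..t} \<phi>"
      unfolding \<phi>_def by (intro continuous_intros cont)
    fix s \<epsilon> :: real assume s: "0 \<le> s" "s < t" and \<epsilon>: "0 < \<epsilon>"
    define \<epsilon>' where "\<epsilon>' = \<epsilon> / 2 / exp (\<mu> * s)"
    have \<epsilon>': "0 < \<epsilon>'" "exp (\<mu> * s) * \<epsilon>' = \<epsilon> / 2"
      using \<epsilon> by (auto simp: \<epsilon>'_def)
    have "\<forall>\<^sub>F h in at_right 0. exp (\<mu> * (s + h)) * (W s + (- \<mu> * W s + \<epsilon>') * h)
        \<le> exp (\<mu> * (s + 0)) * (W s + (- \<mu> * W s + \<epsilon>') * 0) + \<epsilon> * h"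
    proof (rule eventually_le_of_right_derivative)
      show "((\<lambda>h. exp (\<mu> * (s + h)) * (W s + (- \<mu> * W s + \<epsilon>') * h)) has_real_derivative
          exp (\<mu> * s) * \<epsilon>') (at 0)"
        by (auto intro!: derivative_eq_intros simp: algebra_simps)
    qed (use \<epsilon> \<epsilon>' in simp)
    with der[OF s \<epsilon>'(1)] show "\<forall>\<^sub>F h in at_right 0. \<phi> (s + h) \<le> \<phi> s + \<epsilon> * h"
    proof eventually_elim
      case (elim h)
      then have "exp (\<mu> * (s + h)) * W (s + h) \<le> exp (\<mu> * (s + h)) * (W s + (- \<mu> * W s + \<epsilon>') * h)"
        by (intro mult_left_mono) auto
      also have "\<dots> \<le> \<phi> s + \<epsilon> * h"
        using elim by (simp add: \<phi>_def)
      finally show ?case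
        by (simp add: \<phi>_def)
    qed
  qed
  then show ?thesis
    by (simp add: \<phi>_def exp_minus field_simps)
qed

text \<open>If decay holds only above the level \<open>b\<close>, then \<open>max (W s) b\<close> still never increases. Hence a final value
  above \<open>b\<close> forces \<open>W\<close> to stay above \<open>b\<close> at all earlier times, and the decay holds throughout.\<close>

lemma le_max_of_conditional_decay:
  fixes W :: "real \<Rightarrow> real"
  assumes t: "0 \<le> t" and cont: "continuous_on {0..t} W" and b: "0 \<le> b" and \<mu>: "0 \<le> \<mu>"
    and der: "\<And>s \<epsilon>. 0 \<le> s \<Longrightarrow> s < t \<Longrightarrow> b \<le> W s \<Longrightarrow> 0 < \<epsilon> \<Longrightarrow>
      \<forall>\<^sub>F h in at_right 0. W (s + h) \<le> W s + (- \<mu> * W s + \<epsilon>) * h"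
  shows "W t \<le> max (exp (- \<mu> * t) * W 0) b"
proof (cases "W t \<le> b")
  case False
  have antimono: "max (W t) b \<le> max (W s) b" if s: "0 \<le> s" "s \<le> t" for s
  proof (rule upper_right_derivative_nonpos_imp_le[OF s(2)])
    show "continuous_on {s..t} (\<lambda>s. max (W s) b)"
      by (intro continuous_intros continuous_on_subset[OF cont]) (use s in auto)
    fix r \<epsilon> :: real assume r: "s \<le> r" "r < t" and \<epsilon>: "0 < \<epsilon>"
    show "\<forall>\<^sub>F h in at_right 0. max (W (r + h)) b \<le> max (W r) b + \<epsilon> * h"
    proof (cases "b \<le> W r")
      case True
      have "\<forall>\<^sub>F h in at_right 0. W (r + h) \<le> W r + (- \<mu> * W r + \<epsilon>) * h"
        using r s True \<epsilon> by (intro der) auto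
      then show ?thesis
        using eventually_at_right_less[of "0::real"]
      proof eventually_elim
        case (elim h)
        have "(- \<mu> * W r + \<epsilon>) * h \<le> \<epsilon> * h"
          using True b \<mu> elim by (intro mult_right_mono) auto
        then have "W (r + h) \<le> W r + \<epsilon> * h" "0 \<le> \<epsilon> * h"
          using elim \<epsilon> by (linarith, simp)
        then show ?case
          using True by (auto simp: max_def)
      qed
    next
      case False
      have "continuous_on {r..t} W"
        by (rule continuous_on_subset[OF cont]) (use s r in auto)
      then have "(W \<longlongrightarrow> W r) (at_right r)"
        using r by (auto simp: continuous_on_def at_within_Icc_at_right dest!: bspec[of _ _ r])
      then have "((\<lambda>h. W (h + r)) \<longlongrightarrow> W r) (at_right 0)"
        by (simp only: filterlim_at_right_to_0[of _ _ r])
      then have "\<forall>\<^sub>F h in at_right 0. W (h + r) < b"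
        by (rule order_tendstoD) (use False in simp)
      then show ?thesis
        using eventually_at_right_less[of "0::real"]
        by eventually_elim (use False \<epsilon> in \<open>simp add: max_def add.commute\<close>)
    qed
  qed
  have "W t \<le> exp (- \<mu> * t) * W 0"
  proof (rule le_exp_of_right_derivative[OF t cont])
    fix s \<epsilon> :: real assume s: "0 \<le> s" "s < t" and "0 < \<epsilon>"
    have "b \<le> W s"
      using antimono[of s] s False by (auto simp: max_def split: if_splits)
    then show "\<forall>\<^sub>F h in at_right 0. W (s + h) \<le> W s + (- \<mu> * W s + \<epsilon>) * h"
      using s \<open>0 < \<epsilon>\<close> by (intro der)
  qed
  then show ?thesis by simp
qed simp

text \<open>Along a trajectory up to time \<open>t\<close>, let \<open>m\<close> be the gain of the maximal output. As long as
  \<open>V \<ge> k2 * m powr p\<close>, the state dominates the output and \<open>V\<close> decays at rate \<open>\<alpha> / k2\<close>, so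
  \<open>le_max_of_conditional_decay\<close> applies with level \<open>k2 * m powr p\<close>. The gain is an arbitrary comparison
  function, so that Lyapunov functions in dissipation form are covered too.\<close>

lemma Lyapunov_implication_imp_eOSS:
  fixes T :: "real \<Rightarrow> 'x::banach \<Rightarrow>\<^sub>L 'x" and C :: "'x \<Rightarrow>\<^sub>L 'y::banach"
  assumes T: "C0_semigroup T" and \<kappa>: "\<kappa> \<in> class_K" and p: "0 < p" and V: "coercive V p"
    and cont: "continuous_along_flow T V" and \<alpha>: "0 < \<alpha>"
    and decay: "\<And>x. \<kappa> (norm (C x)) \<le> norm x \<Longrightarrow> lie_deriv T V x \<le> ereal (- \<alpha> * norm x powr p)"
  shows "eOSS T C"
proof -
  obtain k1 k2 where k: "0 < k1" "0 < k2"
    and V_ge: "\<And>x. k1 * norm x powr p \<le> V x" and V_le: "\<And>x. V x \<le> k2 * norm x powr p"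
    using V by (auto simp: coercive_def)
  define q where "q = (k2 / k1) powr (1 / p)"
  define \<mu> where "\<mu> = \<alpha> / k2"
  have q: "0 < q" "q powr p = k2 / k1" and \<mu>: "0 < \<mu>"
    using k p \<alpha> by (auto simp: q_def \<mu>_def powr_powr)
  have bound: "norm (T t x) \<le> q * exp (- (\<mu> / p) * t) * norm x + q * \<kappa> (outp_max T C t x)"
    if t: "0 \<le> t" for t x
  proof -
    define m where "m = \<kappa> (outp_max T C t x)"
    define W where "W s = V (T s x)" for s
    have m: "0 \<le> m"
      using \<kappa> T t by (simp add: m_def class_K_nonneg outp_max_nonneg)
    have "W t \<le> max (exp (- \<mu> * t) * W 0) (k2 * m powr p)"
    proof (rule le_max_of_conditional_decay[OF t])
      have "continuous_on {0..} W"
        using cont by (simp add: continuous_along_flow_def flow_def W_def)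
      then show "continuous_on {0..t} W"
        by (rule continuous_on_subset) auto
      fix s \<epsilon> :: real assume s: "0 \<le> s" "s < t" and W: "k2 * m powr p \<le> W s" and \<epsilon>: "0 < \<epsilon>"
      have "k2 * m powr p \<le> k2 * norm (T s x) powr p"
        using W V_le[of "T s x"] by (simp add: W_def)
      then have "m powr p \<le> norm (T s x) powr p"
        using k by simp
      then have "m \<le> norm (T s x)"
        by (rule powr_le_imp_le[OF p norm_ge_zero])
      moreover have "\<kappa> (norm (C (T s x))) \<le> m"
        unfolding m_def using norm_outp_le_outp_max[OF T, of s t C x] s
        by (intro class_K_mono[OF \<kappa>]) (auto simp: outp_def)
      ultimately have "lie_deriv T V (T s x) \<le> ereal (- \<alpha> * norm (T s x) powr p)"
        by (intro decay) simp
      also have "\<dots> \<le> ereal (- \<mu> * W s)"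
        using mult_left_mono[OF V_le[of "T s x"], of \<mu>] \<mu> k by (simp add: \<mu>_def W_def)
      finally have "\<forall>\<^sub>F h in at_right 0. V (T h (T s x)) \<le> V (T s x) + (- \<mu> * W s + \<epsilon>) * h"
        using \<epsilon> unfolding lie_deriv_le_iff by blast
      then show "\<forall>\<^sub>F h in at_right 0. W (s + h) \<le> W s + (- \<mu> * W s + \<epsilon>) * h"
        using eventually_at_right_less[of "0::real"]
      proof eventually_elim
        case (elim h)
        then show ?case
          using C0_semigroup_add[OF T, of h s x] s by (simp add: W_def add.commute)
      qed
    qed (use k \<mu> in auto)
    also have "exp (- \<mu> * t) * W 0 \<le> k2 * (exp (- (\<mu> / p) * t) * norm x) powr p"
      using V_le[of x] p T by (simp add: W_def powr_mult exp_powr_real)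
    finally have "W t \<le> max (k2 * (exp (- (\<mu> / p) * t) * norm x) powr p) (k2 * m powr p)"
      by simp
    also have "\<dots> \<le> k2 * (exp (- (\<mu> / p) * t) * norm x + m) powr p"
      using k p m by (intro max.boundedI mult_left_mono powr_mono2) auto
    finally have "k1 * norm (T t x) powr p \<le> k2 * (exp (- (\<mu> / p) * t) * norm x + m) powr p"
      using V_ge[of "T t x"] by (simp add: W_def)
    then have "norm (T t x) powr p \<le> k2 / k1 * (exp (- (\<mu> / p) * t) * norm x + m) powr p"
      using k by (simp add: field_simps)
    also have "\<dots> = (q * (exp (- (\<mu> / p) * t) * norm x + m)) powr p"
      using q m by (simp add: powr_mult)
    finally have "norm (T t x) powr p \<le> (q * (exp (- (\<mu> / p) * t) * norm x + m)) powr p" .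
    then have "norm (T t x) \<le> q * (exp (- (\<mu> / p) * t) * norm x + m)"
      by (rule powr_le_imp_le[OF p, rotated]) (use q m in auto)
    then show ?thesis
      by (simp add: m_def algebra_simps)
  qed
  have "eOSS_gain T C (\<lambda>r. q * \<kappa> r)"
    unfolding eOSS_gain_def flow_def using bound q \<mu> p class_K_scale[OF \<kappa>]
    by (intro conjI exI[of _ q] exI[of _ "\<mu> / p"]) auto
  then show ?thesis
    unfolding eOSS_def by blast
qed

lemma has_implication_imp_eOSS:
  assumes T: "C0_semigroup T" and "has_eOSS_Lyapunov_implication_linear T C"
  shows "eOSS T C"
proof -
  obtain V \<kappa> p \<alpha> where \<kappa>: "\<kappa> \<in> class_K" and V: "0 < p" "coercive V p" "continuous_along_flow T V" "0 < \<alpha>"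
    and decay: "\<And>x. \<kappa> (norm (C x)) \<le> norm x \<Longrightarrow> lie_deriv T V x \<le> ereal (- \<alpha> * norm x powr p)"
    using assms(2)
    by (auto simp: has_eOSS_Lyapunov_implication_linear_def eOSS_Lyapunov_implication_def class_K_inf_def)
  show ?thesis
    by (rule Lyapunov_implication_imp_eOSS[OF T \<kappa> V decay])
qed

text \<open>The gain \<open>\<kappa>\<close> is chosen so that \<open>\<kappa> (\<parallel>C x\<parallel>) \<le> \<parallel>x\<parallel>\<close> means \<open>\<sigma> (\<parallel>C x\<parallel>) \<le> \<alpha> / 2 * \<parallel>x\<parallel> powr p\<close>: half of the
  dissipation then absorbs the output term.\<close>

lemma has_dissipation_imp_eOSS:
  fixes T :: "real \<Rightarrow> 'x::banach \<Rightarrow>\<^sub>L 'x" and C :: "'x \<Rightarrow>\<^sub>L 'y::banach"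
  assumes T: "C0_semigroup T" and "has_eOSS_Lyapunov_dissipation_linear T C"
  shows "eOSS T C"
proof -
  obtain V \<sigma> p \<alpha> where \<sigma>: "\<sigma> \<in> class_K" and p: "0 < p" and V: "coercive V p" "continuous_along_flow T V"
    and \<alpha>: "0 < \<alpha>" and diss: "\<And>x. lie_deriv T V x \<le> ereal (- \<alpha> * norm x powr p + \<sigma> (norm (C x)))"
    using assms(2)
    by (auto simp: has_eOSS_Lyapunov_dissipation_linear_def eOSS_Lyapunov_dissipation_def class_K_inf_def)
  define \<kappa> where "\<kappa> r = (2 / \<alpha> * \<sigma> r) powr (1 / p)" for r
  show ?thesis
  proof (rule Lyapunov_implication_imp_eOSS[OF T _ p V])
    show "\<kappa> \<in> class_K"
      unfolding \<kappa>_def using \<alpha> p by (intro class_K_powr class_K_scale \<sigma>) auto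
    fix x assume "\<kappa> (norm (C x)) \<le> norm x"
    then have "\<kappa> (norm (C x)) powr p \<le> norm x powr p"
      using p by (intro powr_mono2) (auto simp: \<kappa>_def)
    then have "\<sigma> (norm (C x)) \<le> \<alpha> / 2 * norm x powr p"
      using p \<alpha> class_K_nonneg[OF \<sigma>, of "norm (C x)"] by (simp add: \<kappa>_def powr_powr field_simps)
    then have "ereal (- \<alpha> * norm x powr p + \<sigma> (norm (C x))) \<le> ereal (- (\<alpha> / 2) * norm x powr p)"
      by simp
    then show "lie_deriv T V x \<le> ereal (- (\<alpha> / 2) * norm x powr p)"
      using diss order_trans by blast
  qed (use \<alpha> in simp)
qed

section \<open>Rescaling and small-gain arguments\<close>

text \<open>The contraction at multiples of \<open>\<tau>\<close> gives a geometric sequence plus the geometric sum \<open>2 * c\<close> of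
  the errors; \<open>K\<close> bridges the rest of the time, which is shorter than \<open>\<tau>\<close>. The step is assumed only along
  the given trajectory and only up to time \<open>t\<close>, since for UGESMO the hypotheses end there.\<close>

lemma contraction_imp_exp_estimate:
  fixes T :: "real \<Rightarrow> 'x::banach \<Rightarrow>\<^sub>L 'x"
  assumes T: "C0_semigroup T" and \<tau>: "0 < \<tau>"
    and K: "\<And>r y. 0 \<le> r \<Longrightarrow> r \<le> \<tau> \<Longrightarrow> norm (T r y) \<le> K * norm y" "0 \<le> K"
    and t: "0 \<le> t" and c: "0 \<le> c"
    and step: "\<And>s. 0 \<le> s \<Longrightarrow> s + \<tau> \<le> t \<Longrightarrow> norm (T (s + \<tau>) x) \<le> norm (T s x) / 2 + c"
  shows "norm (T t x) \<le> 2 * K * exp (- (ln 2 / \<tau>) * t) * norm x + 2 * K * c"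
proof -
  have iter: "norm (T (real k * \<tau>) x) \<le> (1 / 2) ^ k * norm x + 2 * c" if "real k * \<tau> \<le> t" for k
    using that
  proof (induction k)
    case 0
    then show ?case using T c by simp
  next
    case (Suc k)
    have le: "real k * \<tau> + \<tau> \<le> t"
      using Suc.prems by (simp add: algebra_simps)
    then have "norm (T (real k * \<tau>) x) \<le> (1 / 2) ^ k * norm x + 2 * c"
      using \<tau> by (intro Suc.IH) simp
    then show ?case
      using step[OF _ le] \<tau> by (simp add: algebra_simps)
  qed
  define n where "n = nat \<lfloor>t / \<tau>\<rfloor>"
  have n: "real n \<le> t / \<tau>" "t / \<tau> < real n + 1"
    using t \<tau> by (auto simp: n_def)
  then have nt: "real n * \<tau> \<le> t" "t - real n * \<tau> \<le> \<tau>"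
    using \<tau> by (auto simp: field_simps)
  have "(1 / 2) ^ Suc n = exp (- ln 2 :: real) ^ Suc n"
    by (simp add: exp_minus inverse_eq_divide)
  also have "\<dots> = exp (- ln 2 * (real n + 1))"
    by (subst exp_of_nat_mult[symmetric]) (simp add: algebra_simps)
  also have "\<dots> \<le> exp (- ln 2 * (t / \<tau>))"
    using n(2) mult_left_mono[of "t / \<tau>" "real n + 1" "ln 2"] by simp
  finally have half: "(1 / 2) ^ n \<le> 2 * exp (- (ln 2 / \<tau>) * t)"
    by simp
  have "norm (T t x) = norm (T (t - real n * \<tau>) (T (real n * \<tau>) x))"
    using C0_semigroup_diff[OF T, of "real n * \<tau>" t x] nt \<tau> by simp
  also have "\<dots> \<le> K * norm (T (real n * \<tau>) x)"
    using nt by (intro K) auto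
  also have "\<dots> \<le> K * ((1 / 2) ^ n * norm x + 2 * c)"
    using nt by (intro mult_left_mono iter K)
  also have "\<dots> \<le> K * (2 * exp (- (ln 2 / \<tau>) * t) * norm x + 2 * c)"
    by (intro mult_left_mono add_right_mono mult_right_mono half K) auto
  finally show ?thesis
    by (simp add: algebra_simps)
qed

text \<open>By linearity the nonlinear estimate is used at the scale \<open>\<parallel>x\<parallel> = 1\<close> only. If the output stays below
  \<open>\<delta> * \<parallel>x\<parallel>\<close>, then both terms of the estimate for \<open>x / \<parallel>x\<parallel>\<close> at time \<open>\<tau>\<close> are at most \<open>1/4\<close>; otherwise
  \<open>\<parallel>x\<parallel>\<close> itself is bounded by the output divided by \<open>\<delta>\<close>.\<close>

lemma OSS_imp_eOSS_linear:
  fixes T :: "real \<Rightarrow> 'x::banach \<Rightarrow>\<^sub>L 'x" and C :: "'x \<Rightarrow>\<^sub>L 'y::banach"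
  assumes T: "C0_semigroup T" and "OSS T C"
  shows "eOSS_linear T C"
proof -
  obtain \<gamma> \<beta> where \<gamma>: "\<gamma> \<in> class_K" and \<beta>: "\<beta> \<in> class_KL"
    and est: "\<And>x t. 0 \<le> t \<Longrightarrow> norm (T t x) \<le> \<beta> (norm x) t + \<gamma> (outp_max T C t x)"
    using assms(2) by (auto simp: OSS_def OSS_gain_def flow_def)
  have "(\<beta> 1 \<longlongrightarrow> 0) at_top"
    using \<beta> by (auto simp: class_KL_def class_L_def)
  then have "\<forall>\<^sub>F t in at_top. \<beta> 1 t < 1 / 4"
    by (rule order_tendstoD) simp
  then obtain t0 where t0: "\<And>t. t0 \<le> t \<Longrightarrow> \<beta> 1 t < 1 / 4"
    by (auto simp: eventually_at_top_linorder)
  define \<tau> where "\<tau> = max t0 1"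
  have \<tau>: "0 < \<tau>" "\<beta> 1 \<tau> < 1 / 4"
    using t0 by (auto simp: \<tau>_def)
  have "continuous_on {0..} \<gamma>" "\<gamma> 0 = 0"
    using \<gamma> by (auto simp: class_K_def)
  then have "(\<gamma> \<longlongrightarrow> 0) (at 0 within {0..})"
    unfolding continuous_on_def by (metis atLeast_iff order_refl)
  then have "\<forall>\<^sub>F r in at 0 within {0..}. \<gamma> r < 1 / 4"
    by (rule order_tendstoD) simp
  then obtain d where "0 < d" and d: "\<And>r. 0 \<le> r \<Longrightarrow> r \<noteq> 0 \<Longrightarrow> dist r 0 < d \<Longrightarrow> \<gamma> r < 1 / 4"
    by (auto simp: eventually_at)
  define \<delta> where "\<delta> = d / 2"
  have \<delta>: "0 < \<delta>" "\<gamma> \<delta> < 1 / 4"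
    using \<open>0 < d\<close> d[of "d / 2"] by (auto simp: \<delta>_def)
  obtain K where K: "1 \<le> K" "\<And>r y. 0 \<le> r \<Longrightarrow> r \<le> \<tau> \<Longrightarrow> norm (T r y) \<le> K * norm y"
    using C0_semigroup_locally_bounded[OF T, of \<tau>] by metis
  have step: "norm (T \<tau> x) \<le> norm x / 2 + K / \<delta> * outp_max T C \<tau> x" for x
  proof (cases "outp_max T C \<tau> x \<le> \<delta> * norm x")
    case True
    show ?thesis
    proof (cases "x = 0")
      case False
      define u where "u = x /\<^sub>R norm x"
      have u: "norm u = 1"
        using False by (auto simp: u_def)
      have scale: "T s x = norm x *\<^sub>R T s u" for s
        using False by (simp add: u_def blinfun.scaleR_right)
      have "norm (outp T C s u) \<le> \<delta>" if "s \<in> {0..\<tau>}" for s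
      proof -
        have "norm x * norm (outp T C s u) = norm (outp T C s x)"
          by (simp add: outp_def scale blinfun.scaleR_right)
        also have "\<dots> \<le> norm x * \<delta>"
          using True norm_outp_le_outp_max[OF T, of s \<tau> C x] that by (simp add: mult.commute)
        finally show ?thesis
          using False by simp
      qed
      then have "outp_max T C \<tau> u \<le> \<delta>"
        using \<tau> by (simp add: outp_max_le_iff[OF T])
      then have "\<gamma> (outp_max T C \<tau> u) \<le> \<gamma> \<delta>"
        using \<tau> by (intro class_K_mono[OF \<gamma>] outp_max_nonneg T) auto
      then have "norm (T \<tau> u) \<le> 1 / 2"
        using est[of \<tau> u] u \<tau> \<delta> by simp
      then have "norm x * norm (T \<tau> u) \<le> norm x * (1 / 2)"
        by (intro mult_left_mono) auto
      moreover have "norm x * norm (T \<tau> u) = norm (T \<tau> x)"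
        by (simp add: scale)
      ultimately show ?thesis
        using outp_max_nonneg[OF T, of \<tau> C x] \<tau> K \<delta> by (simp add: add_increasing2)
    qed (use outp_max_nonneg[OF T, of \<tau> C x] \<tau> K \<delta> in simp)
  next
    case False
    have "norm (T \<tau> x) \<le> K * norm x"
      using K \<tau> by simp
    also have "\<dots> \<le> K * (outp_max T C \<tau> x / \<delta>)"
      using False K \<delta> by (intro mult_left_mono) (auto simp: field_simps)
    finally show ?thesis
      by (simp add: add_increasing)
  qed
  have bound: "norm (T t x) \<le> 2 * K * exp (- (ln 2 / \<tau>) * t) * norm x + 2 * K * (K / \<delta>) * outp_max T C t x"
    if t: "0 \<le> t" for t x
  proof -
    have "norm (T t x) \<le> 2 * K * exp (- (ln 2 / \<tau>) * t) * norm x + 2 * K * (K / \<delta> * outp_max T C t x)"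
    proof (rule contraction_imp_exp_estimate[OF T \<tau>(1) K(2) _ t])
      fix s assume s: "0 \<le> s" "s + \<tau> \<le> t"
      have "norm (outp T C r (T s x)) \<le> outp_max T C t x" if "r \<in> {0..\<tau>}" for r
        using norm_outp_le_outp_max[OF T, of "r + s" t C x] C0_semigroup_add[OF T, of r s x] that s
        by (simp add: outp_def)
      then have "outp_max T C \<tau> (T s x) \<le> outp_max T C t x"
        using \<tau> by (simp add: outp_max_le_iff[OF T])
      then have "K / \<delta> * outp_max T C \<tau> (T s x) \<le> K / \<delta> * outp_max T C t x"
        using K \<delta> by (intro mult_left_mono) auto
      then show "norm (T (s + \<tau>) x) \<le> norm (T s x) / 2 + K / \<delta> * outp_max T C t x"
        using step[of "T s x"] C0_semigroup_add[OF T, of \<tau> s x] s \<tau> by (simp add: add.commute)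
    qed (use K(1) \<delta> outp_max_nonneg[OF T t, of C x] in auto)
    then show ?thesis
      by (simp add: mult.assoc)
  qed
  have "0 < 2 * K * (K / \<delta>)" "0 < 2 * K" "0 < ln 2 / \<tau>"
    using K(1) \<delta> \<tau> by auto
  then have "eOSS_gain T C (\<lambda>r. 2 * K * (K / \<delta>) * r)"
    unfolding eOSS_gain_def flow_def using bound linear_in_class_K by blast
  then show ?thesis
    unfolding eOSS_linear_def linear_gain_def by blast
qed

lemma eOSS_gain_imp_OSS_gain:
  assumes "eOSS_gain T C \<gamma>"
  shows "OSS_gain T C \<gamma>"
proof -
  obtain M \<mu> where "0 < M" "0 < \<mu>" and \<gamma>: "\<gamma> \<in> class_K"
    and est: "\<And>x t. 0 \<le> t \<Longrightarrow> norm (flow T t x) \<le> M * exp (- \<mu> * t) * norm x + \<gamma> (outp_max T C t x)"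
    using assms by (auto simp: eOSS_gain_def)
  then show ?thesis
    unfolding OSS_gain_def
    by (intro conjI bexI[of _ "\<lambda>r t. M * exp (- \<mu> * t) * r"] exp_in_class_KL) auto
qed

text \<open>On a time window of length \<open>\<tau>\<close> the state is at most \<open>K * \<parallel>x\<parallel>\<close>, so an output dominated by
  \<open>1 / \<rho>\<close> times the state contributes at most \<open>c * K / \<rho> * \<parallel>x\<parallel>\<close>. With \<open>\<rho> \<ge> 4 * c * K\<close> and
  \<open>M * exp (- \<mu> * \<tau>) \<le> 1/4\<close> the norm halves on every window.\<close>

lemma eOSS_linear_imp_UGESMO:
  fixes T :: "real \<Rightarrow> 'x::banach \<Rightarrow>\<^sub>L 'x" and C :: "'x \<Rightarrow>\<^sub>L 'y::banach"
  assumes T: "C0_semigroup T" and "eOSS_linear T C"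
  shows "UGESMO T C"
proof -
  obtain \<gamma> M \<mu> c where \<gamma>: "\<gamma> \<in> class_K" "\<And>r. 0 \<le> r \<Longrightarrow> \<gamma> r = c * r" and M: "0 < M" and \<mu>: "0 < \<mu>"
    and est: "\<And>x t. 0 \<le> t \<Longrightarrow> norm (T t x) \<le> M * exp (- \<mu> * t) * norm x + \<gamma> (outp_max T C t x)"
    using assms(2) by (auto simp: eOSS_linear_def eOSS_gain_def linear_gain_def flow_def)
  have c: "0 \<le> c"
    using class_K_nonneg[OF \<gamma>(1), of 1] \<gamma>(2)[of 1] by simp
  have "((\<lambda>t. M * exp (- \<mu> * t)) \<longlongrightarrow> 0) at_top"
    using \<mu> by real_asymp
  then have "\<forall>\<^sub>F t in at_top. M * exp (- \<mu> * t) < 1 / 4"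
    by (rule order_tendstoD) simp
  then obtain t0 where t0: "\<And>t. t0 \<le> t \<Longrightarrow> M * exp (- \<mu> * t) < 1 / 4"
    by (auto simp: eventually_at_top_linorder)
  define \<tau> where "\<tau> = max t0 1"
  have \<tau>: "0 < \<tau>" "M * exp (- \<mu> * \<tau>) < 1 / 4"
    using t0[of \<tau>] by (auto simp: \<tau>_def)
  obtain K where K: "1 \<le> K" "\<And>r y. 0 \<le> r \<Longrightarrow> r \<le> \<tau> \<Longrightarrow> norm (T r y) \<le> K * norm y"
    using C0_semigroup_locally_bounded[OF T, of \<tau>] by metis
  \<comment> \<open>\<open>c + 1\<close> instead of \<open>c\<close> keeps \<open>\<rho>\<close> positive\<close>
  define \<rho> where "\<rho> = 4 * (c + 1) * K"
  have \<rho>: "0 < \<rho>" "c * K \<le> \<rho> / 4"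
    using c K(1) by (simp add: \<rho>_def, simp add: \<rho>_def distrib_right)
  have step: "norm (T \<tau> x) \<le> norm x / 2"
    if E: "\<And>s. s \<in> {0..\<tau>} \<Longrightarrow> \<rho> * norm (outp T C s x) \<le> norm (T s x)" for x
  proof -
    have "norm (outp T C s x) \<le> K * norm x / \<rho>" if "s \<in> {0..\<tau>}" for s
      using E[OF that] K(2)[of s x] that \<rho> by (simp add: field_simps)
    then have "outp_max T C \<tau> x \<le> K * norm x / \<rho>"
      using \<tau> by (simp add: outp_max_le_iff[OF T])
    then have "c * outp_max T C \<tau> x \<le> c * (K * norm x / \<rho>)"
      using c by (intro mult_left_mono)
    also have "\<dots> = c * K / \<rho> * norm x"
      by simp
    also have "\<dots> \<le> 1 / 4 * norm x"
      using \<rho> by (intro mult_right_mono) (auto simp: field_simps)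
    finally have "\<gamma> (outp_max T C \<tau> x) \<le> 1 / 4 * norm x"
      using \<gamma>(2)[OF outp_max_nonneg[OF T, of \<tau> C x]] \<tau> by simp
    moreover have "M * exp (- \<mu> * \<tau>) * norm x \<le> 1 / 4 * norm x"
      using \<tau> by (intro mult_right_mono) auto
    ultimately show ?thesis
      using est[of \<tau> x] \<tau> by simp
  qed
  have "norm (T t x) \<le> 2 * K * exp (- (ln 2 / \<tau>) * t) * norm x"
    if E: "\<forall>s\<in>{0..\<sigma>}. \<rho> * norm (outp T C s x) \<le> norm (T s x)" and t: "t \<in> {0..\<sigma>}" for x t \<sigma>
  proof -
    have "norm (T t x) \<le> 2 * K * exp (- (ln 2 / \<tau>) * t) * norm x + 2 * K * 0"
    proof (rule contraction_imp_exp_estimate[OF T \<tau>(1) K(2)])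
      fix s assume s: "0 \<le> s" "s + \<tau> \<le> t"
      have "norm (T \<tau> (T s x)) \<le> norm (T s x) / 2"
      proof (rule step)
        fix r assume r: "r \<in> {0..\<tau>}"
        then show "\<rho> * norm (outp T C r (T s x)) \<le> norm (T r (T s x))"
          using E[rule_format, of "r + s"] s t C0_semigroup_add[OF T, of r s x] by (simp add: outp_def)
      qed
      then show "norm (T (s + \<tau>) x) \<le> norm (T s x) / 2 + 0"
        using C0_semigroup_add[OF T, of \<tau> s x] s \<tau> by (simp add: add.commute)
    qed (use t K in auto)
    then show ?thesis by simp
  qed
  moreover have "0 < 2 * K" "0 < ln 2 / \<tau>"
    using K(1) \<tau> by auto
  ultimately show ?thesis
    unfolding UGESMO_def flow_def using \<rho>(1) by blast
qed

lemma UGESMO_imp_exp_zero_detectable: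
  assumes "UGESMO T C"
  shows "exp_zero_detectable T C"
proof -
  obtain \<rho> M \<mu> where M: "0 < M" "0 < \<mu>"
    and est: "\<forall>x. \<forall>\<tau>\<ge>0. (\<forall>t\<in>{0..\<tau>}. \<rho> * norm (outp T C t x) \<le> norm (flow T t x)) \<longrightarrow>
        (\<forall>t\<in>{0..\<tau>}. norm (flow T t x) \<le> M * exp (- \<mu> * t) * norm x)"
    using assms unfolding UGESMO_def by blast
  have "norm (flow T t x) \<le> M * exp (- \<mu> * t) * norm x"
    if "\<forall>t\<ge>0. outp T C t x = 0" "0 \<le> t" for x t
    using est[rule_format, of t x t] that by simp
  then show ?thesis
    unfolding exp_zero_detectable_def using M by blast
qed

section \<open>A converse Lyapunov theorem\<close>

text \<open>For continuous \<open>b\<close> this is the supremum over \<open>r \<ge> t\<close> of \<open>min (a r) (inf over s in {t..r} of b s)\<close>: the best reward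
  \<open>a\<close> that can be collected after time \<open>t\<close>, capped by the smallest penalty \<open>b\<close> met on the way. Describing it
  by the levels \<open>c\<close> below both reward and penalty avoids nested infima.\<close>

definition max_min_value :: "(real \<Rightarrow> real) \<Rightarrow> (real \<Rightarrow> real) \<Rightarrow> real \<Rightarrow> real" where
  "max_min_value a b t = Sup {c. \<exists>r\<ge>t. c \<le> a r \<and> (\<forall>s\<in>{t..r}. c \<le> b s)}"

lemma max_min_value_upper:
  assumes "t \<le> r" "c \<le> a r" "\<And>s. s \<in> {t..r} \<Longrightarrow> c \<le> b s"
  shows "c \<le> max_min_value a b t"
  unfolding max_min_value_def by (rule cSup_upper) (use assms in \<open>auto intro!: bdd_aboveI[of _ "b t"]\<close>)

lemma max_min_value_least:
  assumes "\<And>c r. t \<le> r \<Longrightarrow> c \<le> a r \<Longrightarrow> (\<And>s. s \<in> {t..r} \<Longrightarrow> c \<le> b s) \<Longrightarrow> c \<le> u"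
  shows "max_min_value a b t \<le> u"
  unfolding max_min_value_def
proof (rule cSup_least)
  have "min (a t) (b t) \<in> {c. \<exists>r\<ge>t. c \<le> a r \<and> (\<forall>s\<in>{t..r}. c \<le> b s)}"
    by (auto intro!: exI[of _ t])
  then show "{c. \<exists>r\<ge>t. c \<le> a r \<and> (\<forall>s\<in>{t..r}. c \<le> b s)} \<noteq> {}"
    by blast
qed (use assms in auto)

lemma max_min_value_le: "max_min_value a b t \<le> b t"
  by (rule max_min_value_least) auto

lemma max_min_value_ge: "a t \<le> b t \<Longrightarrow> a t \<le> max_min_value a b t"
  by (rule max_min_value_upper[of t t]) auto

text \<open>Starting a trajectory later shifts its reward and penalty in time and rescales them by a power
  of the exponential weight.\<close>

lemma max_min_value_scale_shift:
  assumes k: "0 < k"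
    and a: "\<And>r. 0 \<le> r \<Longrightarrow> a' r = k * a (r + h)" and b: "\<And>r. 0 \<le> r \<Longrightarrow> b' r = k * b (r + h)"
  shows "max_min_value a' b' 0 = k * max_min_value a b h"
proof (rule antisym)
  show "max_min_value a' b' 0 \<le> k * max_min_value a b h"
  proof (rule max_min_value_least)
    fix c r assume r: "0 \<le> r" "c \<le> a' r" and c: "\<And>s. s \<in> {0..r} \<Longrightarrow> c \<le> b' s"
    have "c / k \<le> max_min_value a b h"
    proof (rule max_min_value_upper[of h "r + h"])
      show "c / k \<le> a (r + h)"
        using r a[of r] k by (simp add: field_simps)
      show "c / k \<le> b s" if "s \<in> {h..r + h}" for s
        using c[of "s - h"] b[of "s - h"] that k by (simp add: field_simps)
    qed (use r in simp)
    then show "c \<le> k * max_min_value a b h"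
      using k by (simp add: field_simps)
  qed
  have "max_min_value a b h \<le> max_min_value a' b' 0 / k"
  proof (rule max_min_value_least)
    fix c r assume r: "h \<le> r" "c \<le> a r" and c: "\<And>s. s \<in> {h..r} \<Longrightarrow> c \<le> b s"
    have "k * c \<le> max_min_value a' b' 0"
    proof (rule max_min_value_upper[of 0 "r - h"])
      show "k * c \<le> a' (r - h)"
        using r a[of "r - h"] k by simp
      show "k * c \<le> b' s" if "s \<in> {0..r - h}" for s
        using c[of "s + h"] b[of s] that k by simp
    qed (use r in simp)
    then show "c \<le> max_min_value a' b' 0 / k"
      using k by (simp add: field_simps)
  qed
  then show "k * max_min_value a b h \<le> max_min_value a' b' 0"
    using k by (simp add: field_simps)
qed

text \<open>Moving the starting time from \<open>u\<close> back to \<open>t\<close> adds rewards in \<open>{t..u}\<close>, which exceed \<open>a u\<close> by at most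
  \<open>\<epsilon>\<close>, and penalties in \<open>{t..u}\<close>, which undercut \<open>b u\<close> by at most \<open>\<epsilon>\<close>. As the value at \<open>u\<close> lies between
  \<open>a u\<close> and \<open>b u\<close>, neither changes it by more than \<open>\<epsilon>\<close>.\<close>

lemma max_min_value_close:
  assumes ab: "a u \<le> b u" and tu: "t \<le> u"
    and a: "\<And>s. s \<in> {t..u} \<Longrightarrow> a s \<le> a u + \<epsilon>" and b: "\<And>s. s \<in> {t..u} \<Longrightarrow> b u - \<epsilon> \<le> b s"
  shows "\<bar>max_min_value a b t - max_min_value a b u\<bar> \<le> \<epsilon>"
proof -
  have \<epsilon>: "0 \<le> \<epsilon>"
    using a[of u] tu by simp
  have "max_min_value a b t \<le> max_min_value a b u + \<epsilon>"
  proof (rule max_min_value_least)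
    fix c r assume r: "t \<le> r" "c \<le> a r" and c: "\<And>s. s \<in> {t..r} \<Longrightarrow> c \<le> b s"
    show "c \<le> max_min_value a b u + \<epsilon>"
    proof (cases "r \<le> u")
      case True
      then show ?thesis
        using a[of r] r max_min_value_ge[of a u b, OF ab] by simp
    next
      case False
      have "c \<le> max_min_value a b u"
        by (rule max_min_value_upper[of u r]) (use False r c tu in auto)
      then show ?thesis
        using \<epsilon> by simp
    qed
  qed
  moreover have "max_min_value a b u \<le> max_min_value a b t + \<epsilon>"
  proof (rule max_min_value_least)
    fix c r assume r: "u \<le> r" "c \<le> a r" and c: "\<And>s. s \<in> {u..r} \<Longrightarrow> c \<le> b s"
    have "c - \<epsilon> \<le> max_min_value a b t"
    proof (rule max_min_value_upper[of t r])
      show "c - \<epsilon> \<le> b s" if "s \<in> {t..r}" for s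
        using c[of s] c[of u] b[of s] that \<epsilon> r by (cases "s \<le> u") auto
    qed (use r tu \<epsilon> in auto)
    then show "c \<le> max_min_value a b t + \<epsilon>"
      by simp
  qed
  ultimately show ?thesis
    by (simp add: abs_le_iff)
qed

lemma continuous_on_max_min_value:
  assumes ab: "\<And>t. 0 \<le> t \<Longrightarrow> a t \<le> b t"
    and a: "continuous_on {0..} a" and b: "continuous_on {0..} b"
  shows "continuous_on {0..} (max_min_value a b)"
  unfolding continuous_on_iff
proof safe
  fix t e :: real assume t: "0 \<le> t" and e: "0 < e"
  obtain d1 where d1: "0 < d1" "\<And>s. 0 \<le> s \<Longrightarrow> dist s t < d1 \<Longrightarrow> dist (a s) (a t) < e / 3"
    using a[unfolded continuous_on_iff, rule_format, of t "e / 3"] t e by auto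
  obtain d2 where d2: "0 < d2" "\<And>s. 0 \<le> s \<Longrightarrow> dist s t < d2 \<Longrightarrow> dist (b s) (b t) < e / 3"
    using b[unfolded continuous_on_iff, rule_format, of t "e / 3"] t e by auto
  define d where "d = min d1 d2"
  have close: "\<bar>max_min_value a b u - max_min_value a b v\<bar> \<le> 2 * e / 3"
    if "0 \<le> u" "u \<le> v" "t - d < u" "v < t + d" for u v
  proof (rule max_min_value_close)
    fix s assume s: "s \<in> {u..v}"
    have "dist s t < d1" "dist v t < d1" "dist s t < d2" "dist v t < d2" "0 \<le> s" "0 \<le> v"
      using that s by (auto simp: d_def dist_real_def)
    then have "dist (a s) (a t) < e / 3" "dist (a v) (a t) < e / 3"
        "dist (b s) (b t) < e / 3" "dist (b v) (b t) < e / 3"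
      using d1(2) d2(2) by blast+
    then show "a s \<le> a v + 2 * e / 3" "b v - 2 * e / 3 \<le> b s"
      unfolding dist_real_def by linarith+
  qed (use that ab in auto)
  show "\<exists>d>0. \<forall>s\<in>{0..}. dist s t < d \<longrightarrow> dist (max_min_value a b s) (max_min_value a b t) < e"
  proof (intro exI[of _ d] conjI ballI impI)
    fix s assume s: "s \<in> {0..}" "dist s t < d"
    then have "\<bar>max_min_value a b s - max_min_value a b t\<bar> \<le> 2 * e / 3"
      using close[of s t] close[of t s] t by (cases "s \<le> t") (auto simp: dist_real_def abs_minus_commute)
    then show "dist (max_min_value a b s) (max_min_value a b t) < e"
      using e by (simp add: dist_real_def)
  qed (use d1 d2 in \<open>simp add: d_def\<close>)
qed

text \<open>The witness is the least zero of \<open>g\<close>: by the intermediate value theorem a negative value before it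
  would produce a smaller zero.\<close>

lemma first_zero_before_negative:
  fixes g :: "real \<Rightarrow> real"
  assumes cont: "continuous_on {h..r} g" and h: "0 \<le> g h" and neg: "u \<in> {h..r}" "g u < 0"
  obtains z where "z \<in> {h..r}" "g z = 0" "\<And>s. s \<in> {h..z} \<Longrightarrow> 0 \<le> g s"
proof -
  define Z where "Z = {s \<in> {h..r}. g s = 0}"
  have zero_before: "\<exists>z\<in>Z. z \<le> v" if "v \<in> {h..r}" "g v < 0" for v
    using IVT2'[of g v 0 h] h that continuous_on_subset[OF cont, of "{h..v}"]
    by (force simp: Z_def)
  have "closed Z"
    unfolding Z_def by (intro continuous_closed_preimage_constant cont) auto
  moreover have Z: "Z \<noteq> {}" "bdd_below Z"
    using zero_before[OF neg] by (auto simp: Z_def intro!: bdd_belowI[of _ h])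
  ultimately have inf: "Inf Z \<in> Z"
    by (intro closed_contains_Inf)
  have "0 \<le> g s" if s: "s \<in> {h..Inf Z}" for s
  proof (rule ccontr)
    assume "\<not> 0 \<le> g s"
    then obtain z where z: "z \<in> Z" "z \<le> s"
      using zero_before[of s] s inf by (auto simp: Z_def)
    then have "z = s"
      using cInf_lower[OF z(1) Z(2)] s by auto
    then show False
      using z \<open>\<not> 0 \<le> g s\<close> by (simp add: Z_def)
  qed
  then show ?thesis
    using that inf by (auto simp: Z_def)
qed

text \<open>The function \<open>g x = \<parallel>x\<parallel> - \<rho> * \<parallel>C x\<parallel>\<close> is nonnegative on the decay region of UGESMO. The Lyapunov
  function \<open>V\<close> is the max-min value of the weighted norm \<open>a\<close> with penalty \<open>b\<close>, the weighted maximum of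
  \<open>\<parallel>x\<parallel>\<close> and \<open>4 * M * g x\<close>. Since \<open>\<parallel>x\<parallel> = a x 0 \<le> V x \<le> b x 0\<close>, it is equivalent to the norm, and it is
  continuous along trajectories by \<open>continuous_on_max_min_value\<close>.

  The value at time \<open>h\<close> is at most \<open>M * a x h\<close>: either the trajectory stays in the decay region, where UGESMO
  bounds the reward, or it reaches the boundary \<open>g = 0\<close>, where the penalty equals the reward and UGESMO
  up to that moment bounds both. If \<open>\<parallel>x\<parallel> \<ge> 2 * \<rho> * \<parallel>C x\<parallel>\<close>, then \<open>4 * M * g x \<ge> 2 * M * \<parallel>x\<parallel>\<close>, so that the
  penalty near time 0 exceeds every level that can be attained later. It is then harmless to prepend
  the time before \<open>h\<close>, which gives \<open>V (T h x) \<le> exp (- \<mu> * h) * V x\<close>.\<close>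

lemma UGESMO_imp_implication:
  fixes T :: "real \<Rightarrow> 'x::banach \<Rightarrow>\<^sub>L 'x" and C :: "'x \<Rightarrow>\<^sub>L 'y::banach"
  assumes T: "C0_semigroup T" and "UGESMO T C"
  shows "has_eOSS_Lyapunov_implication_linear T C"
proof -
  obtain \<rho> M0 \<mu> where \<rho>: "0 < \<rho>" and \<mu>: "0 < \<mu>"
    and est0: "\<forall>x. \<forall>\<tau>\<ge>0. (\<forall>t\<in>{0..\<tau>}. \<rho> * norm (outp T C t x) \<le> norm (flow T t x)) \<longrightarrow>
        (\<forall>t\<in>{0..\<tau>}. norm (flow T t x) \<le> M0 * exp (- \<mu> * t) * norm x)"
    using assms(2) unfolding UGESMO_def by blast
  \<comment> \<open>\<open>M \<ge> 1\<close> covers levels that are stopped at once, outside the decay region\<close>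
  define M where "M = max M0 1"
  have M: "1 \<le> M"
    by (simp add: M_def)
  define g where "g x = norm x - \<rho> * norm (C x)" for x
  have est: "norm (T t x) \<le> M * exp (- \<mu> * t) * norm x"
    if t: "0 \<le> t" and E: "\<And>s. s \<in> {0..t} \<Longrightarrow> 0 \<le> g (T s x)" for x t
  proof -
    have "norm (T t x) \<le> M0 * exp (- \<mu> * t) * norm x"
      using est0[rule_format, of t x t] t E by (simp add: flow_def outp_def g_def)
    also have "\<dots> \<le> M * exp (- \<mu> * t) * norm x"
      by (intro mult_right_mono) (auto simp: M_def)
    finally show ?thesis .
  qed
  define a where "a x t = exp (\<mu> * t) * norm (T t x)" for x t
  define b where "b x t = exp (\<mu> * t) * max (norm (T t x)) (4 * M * g (T t x))" for x t
  define V where "V x = max_min_value (a x) (b x) 0" for x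
  have cont_T: "continuous_on {0..} (\<lambda>t. T t x)" for x
    by (rule continuous_on_C0_semigroup[OF T])
  have cont_a: "continuous_on {0..} (a x)" and cont_b: "continuous_on {0..} (b x)"
      and cont_g: "continuous_on {0..} (\<lambda>t. g (T t x))" for x
    unfolding a_def b_def g_def by (intro continuous_intros cont_T)+
  have ab: "a x t \<le> b x t" for x t
    by (simp add: a_def b_def)
  have V_ge: "norm x \<le> V x" for x
    using max_min_value_ge[of "a x" 0 "b x"] ab[of x 0] T by (simp add: V_def a_def)
  have V_le: "V x \<le> 4 * M * norm x" for x
  proof -
    have "V x \<le> max (norm x) (4 * M * g x)"
      using max_min_value_le[of "a x" "b x" 0] T by (simp add: V_def b_def)
    also have "\<dots> \<le> 4 * M * norm x"
    proof (rule max.boundedI)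
      show "norm x \<le> 4 * M * norm x"
        using mult_right_mono[of 1 "4 * M" "norm x"] M by simp
      show "4 * M * g x \<le> 4 * M * norm x"
        using M \<rho> by (intro mult_left_mono) (auto simp: g_def)
    qed
    finally show ?thesis .
  qed
  have V_T: "V (T h x) = exp (- \<mu> * h) * max_min_value (a x) (b x) h" if h: "0 \<le> h" for h x
    unfolding V_def
    by (rule max_min_value_scale_shift)
      (auto simp: a_def b_def C0_semigroup_add[OF T _ h] distrib_left exp_add exp_minus)
  have value_le: "max_min_value (a x) (b x) h \<le> M * a x h" if h: "0 \<le> h" for h x
  proof (rule max_min_value_least)
    fix c r assume r: "h \<le> r" "c \<le> a x r" and c: "\<And>s. s \<in> {h..r} \<Longrightarrow> c \<le> b x s"
    have decay: "a x t \<le> M * a x h" if t: "h \<le> t" and E: "\<And>s. s \<in> {h..t} \<Longrightarrow> 0 \<le> g (T s x)" for t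
    proof -
      have "norm (T (t - h) (T h x)) \<le> M * exp (- \<mu> * (t - h)) * norm (T h x)"
      proof (rule est)
        show "0 \<le> g (T s (T h x))" if "s \<in> {0..t - h}" for s
          using E[of "s + h"] that h C0_semigroup_add[OF T, of s h x] by simp
      qed (use t in simp)
      then have "exp (\<mu> * t) * norm (T t x) \<le> exp (\<mu> * t) * (M * exp (- \<mu> * (t - h)) * norm (T h x))"
        using C0_semigroup_diff[OF T h t, of x] by simp
      also have "\<dots> = M * (exp (\<mu> * t + - \<mu> * (t - h)) * norm (T h x))"
        by (simp only: exp_add mult_ac)
      also have "\<mu> * t + - \<mu> * (t - h) = \<mu> * h"
        by (simp add: algebra_simps)
      finally show ?thesis
        by (simp add: a_def)
    qed
    have b_eq_a: "b x s = a x s" if "g (T s x) \<le> 0" for s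
    proof -
      have "4 * M * g (T s x) \<le> 0"
        using that M by (simp add: mult_nonneg_nonpos)
      then have "4 * M * g (T s x) \<le> norm (T s x)"
        using norm_ge_zero order_trans by blast
      then show ?thesis
        by (simp add: a_def b_def max_absorb1)
    qed
    consider "g (T h x) < 0" | "\<And>s. s \<in> {h..r} \<Longrightarrow> 0 \<le> g (T s x)"
      | u where "0 \<le> g (T h x)" "u \<in> {h..r}" "g (T u x) < 0"
      by force
    then show "c \<le> M * a x h"
    proof cases
      case 1
      then have "c \<le> a x h"
        using c[of h] r b_eq_a[of h] by simp
      also have "\<dots> \<le> M * a x h"
        using mult_right_mono[of 1 M "a x h"] M by (simp add: a_def)
      finally show ?thesis .
    next
      case 2
      then show ?thesis
        using decay[of r] r by simp
    next
      case (3 u)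
      have "continuous_on {h..r} (\<lambda>t. g (T t x))"
        by (rule continuous_on_subset[OF cont_g]) (use h in auto)
      then obtain z where z: "z \<in> {h..r}" "g (T z x) = 0" "\<And>s. s \<in> {h..z} \<Longrightarrow> 0 \<le> g (T s x)"
        using first_zero_before_negative[of h r "\<lambda>t. g (T t x)"] 3 by metis
      then show ?thesis
        using c[of z] b_eq_a[of z] decay[of z] by simp
    qed
  qed
  have decay: "lie_deriv T V x \<le> ereal (- \<mu> * norm x)" if x: "2 * \<rho> * norm (C x) \<le> norm x" for x
    unfolding lie_deriv_le_iff
  proof (intro allI impI)
    fix \<epsilon> :: real assume \<epsilon>: "0 < \<epsilon>"
    show "\<forall>\<^sub>F h in at_right 0. V (T h x) \<le> V x + (- \<mu> * norm x + \<epsilon>) * h"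
    proof (cases "x = 0")
      case True
      show ?thesis
        using eventually_at_right_less[of "0::real"] by eventually_elim (use True \<epsilon> in simp)
    next
      case False
      have "norm x / 2 \<le> g x"
        using x by (simp add: g_def)
      then have "4 * M * (norm x / 2) \<le> 4 * M * g x"
        using M by (intro mult_left_mono) auto
      then have b0: "2 * M * norm x \<le> b x 0"
        using T by (simp add: b_def)
      have a0: "a x 0 = norm x"
        using T by (simp add: a_def)
      have pos: "0 < M * norm x"
        using M False by simp
      have "continuous_on {0..1} (\<lambda>t. b x t)" "continuous_on {0..1} (\<lambda>t. M * a x t)"
        by (intro continuous_intros continuous_on_subset[OF cont_b] continuous_on_subset[OF cont_a]; auto)+
      then have "((\<lambda>t. b x t) \<longlongrightarrow> b x 0) (at_right 0)" "((\<lambda>t. M * a x t) \<longlongrightarrow> M * a x 0) (at_right 0)"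
        by (auto simp: continuous_on_def at_within_Icc_at_right dest!: bspec[of _ _ 0])
      \<comment> \<open>the level \<open>3/2 * M * \<parallel>x\<parallel>\<close> separates, for small times, all attainable levels from the penalty\<close>
      moreover have b0': "3 / 2 * (M * norm x) < b x 0" and "M * a x 0 < 3 / 2 * (M * norm x)"
        using b0 pos by (linarith, simp add: a0 pos)
      ultimately have "\<forall>\<^sub>F t in at_right 0. 3 / 2 * (M * norm x) < b x t"
          "\<forall>\<^sub>F t in at_right 0. M * a x t < 3 / 2 * (M * norm x)"
        by (blast dest: order_tendstoD)+
      then have "\<forall>\<^sub>F t in at_right 0. M * a x t < 3 / 2 * (M * norm x) \<and> 3 / 2 * (M * norm x) < b x t"
        by (rule eventually_conj[rotated])
      then obtain \<delta> where \<delta>: "0 < \<delta>"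
        "\<And>t. 0 < t \<Longrightarrow> t < \<delta> \<Longrightarrow> M * a x t < 3 / 2 * (M * norm x) \<and> 3 / 2 * (M * norm x) < b x t"
        by (auto simp: eventually_at_right_field)
      have "\<forall>\<^sub>F h in at_right 0. h \<in> {0<..<\<delta>}"
        using \<delta>(1) by (intro eventually_at_right_real) auto
      moreover have "\<forall>\<^sub>F h in at_right 0. exp (- \<mu> * h) * V x \<le> exp (- \<mu> * 0) * V x + (- \<mu> * V x + \<epsilon>) * h"
        by (rule eventually_le_of_right_derivative[where d = "- \<mu> * V x"])
          (use \<epsilon> in \<open>auto intro!: derivative_eq_intros\<close>)
      ultimately show ?thesis
      proof eventually_elim
        case (elim h)
        have "max_min_value (a x) (b x) h \<le> V x"
        proof (rule max_min_value_least)
          fix c r assume r: "h \<le> r" "c \<le> a x r" and c: "\<And>s. s \<in> {h..r} \<Longrightarrow> c \<le> b x s"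
          have "c \<le> max_min_value (a x) (b x) h"
            using r c by (rule max_min_value_upper)
          also have "\<dots> \<le> M * a x h"
            using elim by (intro value_le) simp
          finally have "c \<le> 3 / 2 * (M * norm x)"
            using \<delta>(2)[of h] elim by simp
          then have "c \<le> b x s" if "s \<in> {0..r}" for s
            using c[of s] \<delta>(2)[of s] b0' that elim
            by (cases "s = 0"; cases "h \<le> s") auto
          then show "c \<le> V x"
            unfolding V_def using r elim by (intro max_min_value_upper[of 0 r]) auto
        qed
        then have "V (T h x) \<le> exp (- \<mu> * h) * V x"
          using elim by (simp add: V_T)
        also have "\<dots> \<le> V x + (- \<mu> * V x + \<epsilon>) * h"
          using elim by simp
        also have "\<dots> \<le> V x + (- \<mu> * norm x + \<epsilon>) * h"
          using elim mult_left_mono[OF V_ge[of x], of \<mu>] \<mu>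
          by (intro add_left_mono mult_right_mono) auto
        finally show ?case .
      qed
    qed
  qed
  have "coercive V 1"
    unfolding coercive_def using V_ge V_le M by (intro exI[of _ 1] conjI exI[of _ "4 * M"]) auto
  moreover have "continuous_along_flow T V"
    unfolding continuous_along_flow_def
  proof
    fix x
    have "continuous_on {0..} (\<lambda>t. exp (- \<mu> * t) * max_min_value (a x) (b x) t)"
      by (intro continuous_intros continuous_on_max_min_value cont_a cont_b ab)
    then show "continuous_on {0..} (\<lambda>t. V (flow T t x))"
      by (rule continuous_on_eq) (simp add: flow_def V_T)
  qed
  moreover have "0 \<le> V x" for x
    using V_ge[of x] norm_ge_zero order_trans by blast
  moreover have "lie_deriv T V x \<le> ereal (- \<mu> * norm x powr 1)" if "2 * \<rho> * norm (C x) \<le> norm x" for x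
    using decay[OF that] by simp
  moreover have "(\<lambda>r. 2 * \<rho> * r) \<in> class_K_inf"
    using \<rho> by (intro linear_in_class_K_inf) simp
  ultimately have "eOSS_Lyapunov_implication T C V (\<lambda>r. 2 * \<rho> * r)"
    unfolding eOSS_Lyapunov_implication_def using \<mu> zero_less_one by blast
  then show ?thesis
    unfolding has_eOSS_Lyapunov_implication_linear_def linear_gain_def by blast
qed

section \<open>The equivalences\<close>

theorem theorem4p5:
  fixes D :: "'x::banach set" and A :: "'x \<Rightarrow> 'x"
    and T :: "real \<Rightarrow> 'x \<Rightarrow>\<^sub>L 'x" and C :: "'x \<Rightarrow>\<^sub>L 'y::banach"
  assumes "generates D A T"
  shows "(exp_detectable D A C \<longrightarrow> has_eOSS_Lyapunov_dissipation_linear T C) \<and>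
    (has_eOSS_Lyapunov_dissipation_linear T C \<longrightarrow> has_eOSS_Lyapunov_implication_linear T C) \<and>
    (has_eOSS_Lyapunov_implication_linear T C \<longleftrightarrow> eOSS_linear T C) \<and>
    (eOSS_linear T C \<longleftrightarrow> eOSS T C) \<and>
    (eOSS T C \<longleftrightarrow> OSS_linear T C) \<and>
    (OSS_linear T C \<longleftrightarrow> OSS T C) \<and>
    (OSS T C \<longleftrightarrow> UGESMO T C) \<and>
    (UGESMO T C \<longrightarrow> exp_zero_detectable T C)"
proof -
  note T = generates_C0_semigroup[OF assms]
  have "eOSS_linear T C \<Longrightarrow> eOSS T C" "OSS_linear T C \<Longrightarrow> OSS T C"
    "eOSS_linear T C \<Longrightarrow> OSS_linear T C" "eOSS T C \<Longrightarrow> OSS T C"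
    unfolding eOSS_linear_def eOSS_def OSS_linear_def OSS_def by (blast intro: eOSS_gain_imp_OSS_gain)+
  then show ?thesis
    using exp_detectable_imp_dissipation[OF assms, of C] has_dissipation_imp_eOSS[OF T, of C]
      has_implication_imp_eOSS[OF T, of C] OSS_imp_eOSS_linear[OF T, of C]
      eOSS_linear_imp_UGESMO[OF T, of C] UGESMO_imp_implication[OF T, of C]
      UGESMO_imp_exp_zero_detectable[of T C]
    by blast
qed

end
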